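(* Let $\mathcal{S}\subset\mathbb{T}$ be measurable with $|\mathcal{S}|>0$ and let $\alpha\in[0,1]$. Suppose there exist constants $c,\delta\in(0,1)$ (which may depend on $\alpha$) such that for infinitely many values of $\ell\in\mathbb{N}$ the $\ell$-th multiplicity function $\nu_{\ell,\mathcal{S}}$ satisfies $$\left|\left\{t\in\mathbb{T}:\ \nu_{\ell,\mathcal{S}}(t/\ell)<\delta\ell\right\}\right|<\frac{c}{\ell^{1/\alpha}},$$ where for $\alpha=0$ this condition is understood as $\left|\left\{t\in\mathbb{T}:\ \nu_{\ell,\mathcal{S}}(t/\ell)<\delta\ell\right\}\right|=0$. Then $\mathcal{S}\in\mathcal{A}(\alpha)$. Moreover, if $\alpha=0$ then this condition is also necessary: if $\mathcal{S}\in\mathcal{A}(0)$, then there exist such constants for which the condition holds for infinitely many $\ell\in\mathbb{N}$.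
   Context: $\mathbb{T}=\mathbb{R}/2\pi\mathbb{Z}$ is the circle group, identified with $[0,2\pi)$, with Lebesgue measure $|\cdot|$. All frequency sets are subsets $\Lambda\subset\mathbb{Z}$. For $\ell\in\mathbb{N}$, $\ell\ge1$, the $\ell$-th multiplicity function $\nu_{\ell,\mathcal{S}}:[0,\frac{2\pi}{\ell})\to\{0,1,\ldots,\ell\}$ is $\nu_{\ell,\mathcal{S}}(t)=(\mathbf{1}_{\mathcal{S}}*\delta_{\frac{2\pi}{\ell}\mathbb{Z}})(t)$, i.e. the number of $j\in\{0,\ldots,\ell-1\}$ such that $t+\frac{2\pi j}{\ell}\in\mathcal{S}$. For $\Lambda\subset\mathbb{Z}$ let $E(\Lambda)=\{e^{i\lambda t}\}_{\lambda\in\Lambda}$. $E(\Lambda)$ is a Riesz sequence in $L^2(\mathcal{S})$ if there exist constants $A,B>0$ such that $$A\sum_{\lambda\in\Lambda}|a_\lambda|^2\le\Big\|\sum_{\lambda\in\Lambda}a_\lambda e^{i\lambda t}\Big\|_{L^2(\mathcal{S})}^2\le B\sum_{\lambda\in\Lambda}|a_\lambda|^2$$ for every finite sequence of (complex) coefficients $\{a_\lambda\}$. For $\alpha\in[0,1]$, a set $\mathcal{S}$ belongs to the class $\mathcal{A}(\alpha)$ if there is $\Lambda\subset\mathbb{Z}$ such that $E(\Lambda)$ is a Riesz sequence in $L^2(\mathcal{S})$ and $\Lambda$ contains, for infinitely many $N\in\mathbb{N}$, an arithmetic progression of length $N$ and step $\ell=O(N^\alpha)$; that is, there are a constant $C>0$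 and infinitely many $N\in\mathbb{N}$ for each of which there exist $M\in\mathbb{Z}$ and $\ell\in\mathbb{N}$, $\ell\ge1$, with $\ell\le CN^\alpha$ and $M+\{\ell,2\ell,\ldots,N\ell\}\subset\Lambda$. *)

theory Defs
  imports "HOL-Analysis.Analysis"
begin

text \<open>The circle group is represented by the fundamental domain \<open>[0, 2\<pi>)\<close> with unnormalised
  Lebesgue measure (total mass \<open>2\<pi>\<close>).\<close>

definition circle :: "real set" where
  "circle = {0..<2 * pi}"

text \<open>For \<open>S \<subseteq> circle\<close> this is meant to be used on \<open>0 \<le> t < 2\<pi>/l\<close> only: there the points
  \<open>t + 2\<pi>j/l\<close>, \<open>j < l\<close>, stay in the fundamental domain, so no reduction modulo \<open>2\<pi>\<close> is needed.\<close>

definition multiplicity_fun :: "nat \<Rightarrow> real set \<Rightarrow> real \<Rightarrow> nat" where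
  "multiplicity_fun l S t = card {j. j < l \<and> t + 2 * pi * real j / real l \<in> S}"

definition L2_norm_sq :: "real set \<Rightarrow> (real \<Rightarrow> complex) \<Rightarrow> real" where
  "L2_norm_sq S f = (LINT t:S|lebesgue. (cmod (f t))\<^sup>2)"

definition riesz_sequence :: "int set \<Rightarrow> real set \<Rightarrow> bool" where
  "riesz_sequence \<Lambda> S \<longleftrightarrow>
     (\<exists>A>0. \<exists>B>0. \<forall>F (a :: int \<Rightarrow> complex). finite F \<longrightarrow> F \<subseteq> \<Lambda> \<longrightarrow>
        A * (\<Sum>n\<in>F. (cmod (a n))\<^sup>2)
          \<le> L2_norm_sq S (\<lambda>t. \<Sum>n\<in>F. a n * exp (\<i> * of_int n * of_real t)) \<and>
        L2_norm_sq S (\<lambda>t. \<Sum>n\<in>F. a n * exp (\<i> * of_int n * of_real t))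
          \<le> B * (\<Sum>n\<in>F. (cmod (a n))\<^sup>2))"

text \<open>The restriction \<open>N \<ge> 1\<close> is harmless, as infinitely many \<open>N\<close> are required; it avoids the
  library convention \<open>0 powr 0 = 0\<close>.\<close>

definition class_A :: "real \<Rightarrow> real set set" where
  "class_A \<alpha> = {S. S \<subseteq> circle \<and> S \<in> sets lebesgue \<and>
     (\<exists>\<Lambda> :: int set. riesz_sequence \<Lambda> S \<and>
       (\<exists>C>0. infinite {N :: nat. N \<ge> 1 \<and>
          (\<exists>(M :: int) (l :: nat). l \<ge> 1 \<and> real l \<le> C * real N powr \<alpha> \<and>
             (\<lambda>k. M + int k * int l) ` {1..N} \<subseteq> \<Lambda>)}))}"

definition low_multiplicity_set :: "real \<Rightarrow> nat \<Rightarrow> real set \<Rightarrow> real set" where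
  "low_multiplicity_set \<delta> l S =
     {t \<in> circle. real (multiplicity_fun l S (t / real l)) < \<delta> * real l}"

definition multiplicity_condition :: "real \<Rightarrow> real set \<Rightarrow> bool" where
  "multiplicity_condition \<alpha> S \<longleftrightarrow>
     (\<exists>c \<delta>. 0 < c \<and> c < 1 \<and> 0 < \<delta> \<and> \<delta> < 1 \<and>
        infinite {l :: nat. l \<ge> 1 \<and>
          (if \<alpha> = 0 then measure lebesgue (low_multiplicity_set \<delta> l S) = 0
           else measure lebesgue (low_multiplicity_set \<delta> l S) < c / real l powr (1 / \<alpha>))})"

end

theory Submission
  imports Defs
begin

text \<open>Folding the circle \<open>l\<close> times gives, for a trigonometric polynomial \<open>Q(t) = P(l t)\<close>,
  \<open>\<integral>\<^sub>S |Q|\<^sup>2 = (1/l) \<integral> |P(s)|\<^sup>2 \<nu>(s/l) ds\<close> over the whole circle, where \<open>\<nu>\<close> is the multiplicity function.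

  Sufficiency: \<open>\<nu> \<ge> \<delta> l\<close> off the low-multiplicity set, and a polynomial with \<open>N\<close> frequencies satisfies
  \<open>|P|\<^sup>2 \<le> N \<Sum>|a|\<^sup>2\<close>. So a progression of length \<open>N \<approx> l\<^bsup>1/\<alpha>\<^esup>\<close> and step \<open>l\<close> has lower Riesz bound at
  least \<open>\<delta>\<close>, uniformly in \<open>l\<close>. The progressions are then placed one after another far apart, where
  they are almost orthogonal because the Fourier coefficients of the indicator of \<open>S\<close> tend to \<open>0\<close>.

  Necessity: for \<open>\<alpha> = 0\<close> a single step \<open>l\<close>, and with it every multiple of \<open>l\<close>, occurs with
  arbitrarily long progressions. Hence the lower Riesz bound \<open>A\<close> says
  \<open>\<integral> |P|\<^sup>2 (\<nu>(s/l)/l - A/2\<pi>) ds \<ge> 0\<close> for all \<open>P\<close>; approximating an indicator by \<open>|P|\<^sup>2\<close> shows that the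
  weight is non-negative almost everywhere.\<close>

section \<open>Trigonometric polynomials and the Hermitian form of \<open>L\<^sup>2(S)\<close>\<close>

definition trig_sum :: "int set \<Rightarrow> (int \<Rightarrow> complex) \<Rightarrow> real \<Rightarrow> complex" where
  "trig_sum F a t = (\<Sum>n\<in>F. a n * exp (\<i> * of_int n * of_real t))"

text \<open>The values \<open>fourier_int S (n - m)\<close> are the entries of the Gram matrix of
  the exponentials in L^2(S); up to sign of the frequency and normalisation they are the Fourier
  coefficients of the indicator of \<open>S\<close>.\<close>

definition fourier_int :: "real set \<Rightarrow> int \<Rightarrow> complex" where
  "fourier_int S k = (LINT t:S|lebesgue. exp (\<i> * of_int k * of_real t))"

section \<open>Integrability of bounded functions and of trigonometric sums\<close>

lemma set_integrable_bounded:
  fixes g :: "real \<Rightarrow> 'a::{banach,second_countable_topology}"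
  assumes "S \<in> lmeasurable" "g \<in> borel_measurable lebesgue" "\<And>t. norm (g t) \<le> B"
  shows "set_integrable lebesgue S g"
  unfolding set_integrable_def
  using assms by (intro integrableI_bounded_set_indicator[where B = B]) (auto simp: fmeasurable_def)

lemma borel_measurable_lebesgue_continuous:
  fixes g :: "real \<Rightarrow> 'a::{banach,second_countable_topology}"
  assumes "continuous_on UNIV g"
  shows "g \<in> borel_measurable lebesgue"
  by (intro measurable_completion) (use assms borel_measurable_continuous_onI in auto)

lemma circle_lmeasurable: "circle \<in> lmeasurable"
  unfolding circle_def
  by (rule bounded_set_imp_lmeasurable) (auto intro: bounded_subset[of "{0..2*pi}"])

lemma measure_circle: "measure lebesgue circle = 2 * pi"
  by (simp add: circle_def)

lemma lmeasurable_subset_circle: "S \<subseteq> circle \<Longrightarrow> S \<in> sets lebesgue \<Longrightarrow> S \<in> lmeasurable"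
  using circle_lmeasurable fmeasurableI2 by blast

lemma exp_measurable [measurable]:
  "(\<lambda>t. exp (\<i> * of_int n * of_real t)) \<in> borel_measurable lebesgue"
  by (intro borel_measurable_lebesgue_continuous continuous_intros)

lemma exp_integrable:
  "S \<in> lmeasurable \<Longrightarrow> set_integrable lebesgue S (\<lambda>t. exp (\<i> * of_int n * of_real t))"
  by (rule set_integrable_bounded[where B = 1]) auto

lemma trig_sum_measurable [measurable]: "trig_sum F a \<in> borel_measurable lebesgue"
  unfolding trig_sum_def by measurable

lemma continuous_on_trig_sum: "continuous_on A (trig_sum F a)"
  unfolding trig_sum_def by (intro continuous_intros)

lemma norm_trig_sum_le: "cmod (trig_sum F a t) \<le> (\<Sum>n\<in>F. cmod (a n))"
  unfolding trig_sum_def by (rule order.trans[OF norm_sum]) (simp add: norm_mult)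

text \<open>Cauchy-Schwarz against the constant 1. The factor \<open>card F\<close> is what later
  ties the admissible length of a progression to the measure of the low-multiplicity set.\<close>

lemma norm_trig_sum_sq_le:
  "(cmod (trig_sum F a t))\<^sup>2 \<le> real (card F) * (\<Sum>n\<in>F. (cmod (a n))\<^sup>2)"
proof -
  have "(cmod (trig_sum F a t))\<^sup>2 \<le> (\<Sum>n\<in>F. cmod (a n))\<^sup>2"
    using norm_trig_sum_le by (intro power_mono) auto
  also have "\<dots> \<le> real (card F) * (\<Sum>n\<in>F. (cmod (a n))\<^sup>2)"
    using Cauchy_Schwarz_ineq_sum[of "\<lambda>_. 1" "\<lambda>n. cmod (a n)" F] by simp
  finally show ?thesis .
qed

lemma norm_trig_sum_sq_integrable:
  assumes "S \<in> lmeasurable"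
  shows "set_integrable lebesgue S (\<lambda>t. (cmod (trig_sum F a t))\<^sup>2)"
  by (rule set_integrable_bounded[OF assms, where B = "real (card F) * (\<Sum>n\<in>F. (cmod (a n))\<^sup>2)"])
     (use norm_trig_sum_sq_le in auto)

lemma set_integral_trig_prod:
  assumes "S \<in> lmeasurable"
  shows "(LINT t:S|lebesgue. trig_sum F a t * cnj (trig_sum G b t)) =
         (\<Sum>n\<in>F. \<Sum>m\<in>G. a n * cnj (b m) * fourier_int S (n - m))"
proof -
  have *: "trig_sum F a t * cnj (trig_sum G b t) =
     (\<Sum>n\<in>F. \<Sum>m\<in>G. a n * cnj (b m) * exp (\<i> * of_int (n - m) * of_real t))" for t
    unfolding trig_sum_def
    by (simp add: sum_product exp_cnj mult.assoc mult.left_commute flip: exp_add)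
       (simp add: algebra_simps)
  show ?thesis
    unfolding * fourier_int_def set_lebesgue_integral_def scaleR_sum_right mult_scaleR_right[symmetric]
    using exp_integrable[OF assms, unfolded set_integrable_def]
    by (simp add: Bochner_Integration.integral_sum del: of_int_diff mult_scaleR_right)
qed

lemma trig_prod_integrable:
  assumes "S \<in> lmeasurable"
  shows "set_integrable lebesgue S (\<lambda>t. trig_sum F a t * cnj (trig_sum G b t))"
proof (rule set_integrable_bounded[OF assms])
  show "(\<lambda>t. trig_sum F a t * cnj (trig_sum G b t)) \<in> borel_measurable lebesgue"
    by (intro borel_measurable_lebesgue_continuous continuous_intros continuous_on_trig_sum)
  show "norm (trig_sum F a t * cnj (trig_sum G b t)) \<le> (\<Sum>n\<in>F. cmod (a n)) * (\<Sum>n\<in>G. cmod (b n))" for t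
    unfolding norm_mult complex_mod_cnj by (intro mult_mono norm_trig_sum_le) (auto simp: sum_nonneg)
qed

lemma complex_L2_norm_sq:
  assumes "S \<in> lmeasurable"
  shows "complex_of_real (L2_norm_sq S (trig_sum F a)) =
         (\<Sum>n\<in>F. \<Sum>m\<in>F. a n * cnj (a m) * fourier_int S (n - m))"
  unfolding set_integral_trig_prod[OF assms, symmetric] L2_norm_sq_def
  by (subst set_integral_complex_of_real[symmetric]) (simp add: complex_norm_square[symmetric] del: of_real_power)

section \<open>Orthogonality and Parseval on the full circle\<close>

lemma fourier_int_circle: "fourier_int circle k = (if k = 0 then 2 * pi else 0)"
proof (cases "k = 0")
  case True
  then show ?thesis
    using set_integral_const[OF fmeasurableD[OF circle_lmeasurable] fmeasurableD2[OF circle_lmeasurable, folded infinity_ennreal_def], of "1 :: complex"]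
    by (simp add: fourier_int_def scaleR_conv_of_real measure_circle)
next
  case False
  define g where "g = (\<lambda>t::real. exp (\<i> * of_int k * of_real t) / (\<i> * of_int k))"
  have "((\<lambda>t. exp (\<i> * of_int k * of_real t)) has_integral g (2 * pi) - g 0) {0..2*pi}"
  proof (rule fundamental_theorem_of_calculus)
    fix t :: real
    have "((\<lambda>z. exp (\<i> * of_int k * z) / (\<i> * of_int k)) has_field_derivative
        exp (\<i> * of_int k * of_real t)) (at (of_real t))"
      using False by (auto intro!: derivative_eq_intros)
    then show "(g has_vector_derivative exp (\<i> * of_int k * of_real t)) (at t within {0..2 * pi})"
      unfolding g_def by (rule has_vector_derivative_real_field)
  qed simp
  moreover have "g (2 * pi) = g 0"
    using exp_integer_2pi[of "of_int k"] by (simp add: g_def mult_ac)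
  ultimately have "((\<lambda>t. exp (\<i> * of_int k * of_real t)) has_integral 0) {0..2*pi}" by simp
  then have "((\<lambda>t. exp (\<i> * of_int k * of_real t)) has_integral 0) circle"
    by (subst (asm) has_integral_spike_set_eq[where T = circle])
       (auto intro: negligible_subset[of "{2*pi}"] simp: circle_def)
  then show ?thesis
    using False exp_integrable[OF circle_lmeasurable, of k]
    by (simp add: fourier_int_def set_lebesgue_integral_eq_integral(2) integral_unique)
qed

lemma L2_norm_sq_circle:
  assumes "finite F"
  shows "L2_norm_sq circle (trig_sum F a) = 2 * pi * (\<Sum>n\<in>F. (cmod (a n))\<^sup>2)"
proof -
  have "complex_of_real (L2_norm_sq circle (trig_sum F a)) =
    (\<Sum>n\<in>F. \<Sum>m\<in>F. if m = n then a n * cnj (a m) * (2 * pi) else 0)"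
    unfolding complex_L2_norm_sq[OF circle_lmeasurable] fourier_int_circle
    by (intro sum.cong) auto
  also have "\<dots> = (\<Sum>n\<in>F. complex_of_real (2 * pi * (cmod (a n))\<^sup>2))"
    using assms by (intro sum.cong) (auto simp: mult_ac simp flip: complex_norm_square)
  also have "\<dots> = complex_of_real (2 * pi * (\<Sum>n\<in>F. (cmod (a n))\<^sup>2))"
    by (simp add: sum_distrib_left)
  finally show ?thesis unfolding of_real_eq_iff .
qed

lemma L2_norm_sq_nonneg: "0 \<le> L2_norm_sq S f"
  unfolding L2_norm_sq_def set_lebesgue_integral_def by (intro integral_nonneg_AE) auto

lemma L2_norm_sq_le_circle:
  assumes "S \<subseteq> circle" "S \<in> sets lebesgue" "finite F"
  shows "L2_norm_sq S (trig_sum F a) \<le> 2 * pi * (\<Sum>n\<in>F. (cmod (a n))\<^sup>2)"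
proof -
  have "L2_norm_sq S (trig_sum F a) \<le> L2_norm_sq circle (trig_sum F a)"
    unfolding L2_norm_sq_def set_lebesgue_integral_def
  proof (rule integral_mono)
    show "integrable lebesgue (\<lambda>t. indicat_real S t *\<^sub>R (cmod (trig_sum F a t))\<^sup>2)"
      "integrable lebesgue (\<lambda>t. indicat_real circle t *\<^sub>R (cmod (trig_sum F a t))\<^sup>2)"
      using norm_trig_sum_sq_integrable lmeasurable_subset_circle[OF assms(1,2)] circle_lmeasurable
      unfolding set_integrable_def by blast+
  qed (use assms in \<open>auto simp: indicator_def\<close>)
  then show ?thesis by (simp add: L2_norm_sq_circle assms)
qed

text \<open>Expanding the square isolates the interaction of two blocks of frequencies in a cross
  term that depends only on the differences \<open>n - m\<close>, so moving one block far away can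
  make it small.\<close>

lemma L2_norm_sq_Un:
  assumes S: "S \<in> lmeasurable" and "finite F" "finite G" "F \<inter> G = {}"
  shows "L2_norm_sq S (trig_sum (F \<union> G) a) =
    L2_norm_sq S (trig_sum F a) + L2_norm_sq S (trig_sum G a)
      + 2 * Re (\<Sum>n\<in>F. \<Sum>m\<in>G. a n * cnj (a m) * fourier_int S (n - m))"
proof -
  have *: "(cmod (trig_sum (F \<union> G) a t))\<^sup>2 = (cmod (trig_sum F a t))\<^sup>2 + (cmod (trig_sum G a t))\<^sup>2
     + 2 * Re (trig_sum F a t * cnj (trig_sum G a t))" for t
  proof -
    have "trig_sum (F \<union> G) a t = trig_sum F a t + trig_sum G a t"
      unfolding trig_sum_def using assms by (simp add: sum.union_disjoint)
    then show ?thesis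
      by (simp only: cmod_power2) (simp add: power2_eq_square algebra_simps)
  qed
  have i: "set_integrable lebesgue S (\<lambda>t. Re (trig_sum F a t * cnj (trig_sum G a t)))"
    using integrable_Re[OF trig_prod_integrable[OF S, unfolded set_integrable_def]]
    by (simp add: set_integrable_def)
  have "(LINT t:S|lebesgue. Re (trig_sum F a t * cnj (trig_sum G a t))) =
     Re (LINT t:S|lebesgue. trig_sum F a t * cnj (trig_sum G a t))"
    using trig_prod_integrable[OF S] unfolding set_lebesgue_integral_def set_integrable_def
    by (subst integral_Re[symmetric]) auto
  then show ?thesis
    unfolding L2_norm_sq_def *
    using i norm_trig_sum_sq_integrable[OF S]
    by (simp add: set_integral_add flip: set_integral_trig_prod[OF S] del: times_complex.sel)
qed

section \<open>Unions of far translates\<close>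

text \<open>The Riemann-Lebesgue lemma for the indicator of \<open>S\<close>, in the form needed to
  avoid finitely many bad shifts. It follows from Bessel's inequality: a bounded sum of squares has
  finitely many terms above a threshold.\<close>

lemma finite_fourier_int_large:
  assumes S: "S \<subseteq> circle" "S \<in> sets lebesgue" and "e > 0"
  shows "finite {k. e \<le> cmod (fourier_int S k)}"
proof -
  have Sm: "S \<in> lmeasurable" using S by (rule lmeasurable_subset_circle)
  have bessel: "(\<Sum>n\<in>F. (cmod (fourier_int S n))\<^sup>2) \<le> 4 * pi\<^sup>2" if F: "finite F" "0 \<notin> F" for F
  proof -
    define T where "T = (\<Sum>n\<in>F. (cmod (fourier_int S n))\<^sup>2)"
    \<comment> \<open>With Q the sum of \<open>cnj (fourier_int S n)\<close> times the exponentials,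
      Q integrates to \<open>T\<close> over \<open>S\<close>. Expanding the nonnegative integral of
      |Q - 2 pi|^2 over \<open>S\<close> leaves 2 pi T + 2 pi (2 pi)^2 - 4 pi T, whence T is at most
      4 pi^2.\<close>
    define a where "a = (\<lambda>n. if n = 0 then - complex_of_real (2 * pi) else cnj (fourier_int S n))"
    have "trig_sum F a = trig_sum F (\<lambda>n. cnj (fourier_int S n))"
      unfolding trig_sum_def a_def using F by (intro ext sum.cong) auto
    then have 1: "L2_norm_sq S (trig_sum F a) \<le> 2 * pi * T"
      using L2_norm_sq_le_circle[OF S F(1), of "\<lambda>n. cnj (fourier_int S n)"] by (simp add: T_def)
    have 2: "L2_norm_sq S (trig_sum {0} a) \<le> 2 * pi * (2 * pi)\<^sup>2"
      using L2_norm_sq_le_circle[OF S, of "{0}" a] by (simp add: a_def norm_mult)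
    have "(\<Sum>n\<in>F. \<Sum>m\<in>{0}. a n * cnj (a m) * fourier_int S (n - m)) =
       (\<Sum>n\<in>F. complex_of_real (- 2 * pi * (cmod (fourier_int S n))\<^sup>2))"
      using F by (intro sum.cong) (auto simp: a_def mult.commute simp flip: complex_norm_square)
    then have 3: "Re (\<Sum>n\<in>F. \<Sum>m\<in>{0}. a n * cnj (a m) * fourier_int S (n - m)) = - 2 * pi * T"
      by (simp add: T_def sum_distrib_left)
    have "0 \<le> L2_norm_sq S (trig_sum (F \<union> {0}) a)" by (rule L2_norm_sq_nonneg)
    also have "\<dots> \<le> 2 * pi * T + 2 * pi * (2 * pi)\<^sup>2 + 2 * (- 2 * pi * T)"
    proof -
      have "L2_norm_sq S (trig_sum (F \<union> {0}) a) =
        L2_norm_sq S (trig_sum F a) + L2_norm_sq S (trig_sum {0} a) + 2 * (- 2 * pi * T)"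
        unfolding 3[symmetric] using F by (intro L2_norm_sq_Un[OF Sm]) auto
      then show ?thesis using 1 2 by linarith
    qed
    finally have "2 * pi * T \<le> 2 * pi * (2 * pi)\<^sup>2" by simp
    then show ?thesis unfolding T_def[symmetric] by (simp add: power2_eq_square)
  qed
  have "finite ({k. e \<le> cmod (fourier_int S k)} - {0})"
  proof (rule ccontr)
    assume inf: "infinite ({k. e \<le> cmod (fourier_int S k)} - {0})"
    obtain m :: nat where m: "4 * pi\<^sup>2 / e\<^sup>2 < m" using reals_Archimedean2 by blast
    obtain F where F: "F \<subseteq> {k. e \<le> cmod (fourier_int S k)} - {0}" "finite F" "card F = m"
      using infinite_arbitrarily_large[OF inf] by metis
    have "real m * e\<^sup>2 \<le> (\<Sum>n\<in>F. (cmod (fourier_int S n))\<^sup>2)"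
      using F \<open>e > 0\<close> sum_mono[of F "\<lambda>_. e\<^sup>2" "\<lambda>n. (cmod (fourier_int S n))\<^sup>2"]
      by (force intro: power_mono)
    also have "\<dots> \<le> 4 * pi\<^sup>2" using F by (intro bessel) auto
    finally show False using m \<open>e > 0\<close> by (simp add: field_simps)
  qed
  then show ?thesis by simp
qed

section \<open>Lower Riesz bounds and the gluing of blocks\<close>

definition riesz_lower_bound :: "real set \<Rightarrow> int set \<Rightarrow> real \<Rightarrow> bool" where
  "riesz_lower_bound S \<Lambda> A \<longleftrightarrow> (\<forall>F a. finite F \<longrightarrow> F \<subseteq> \<Lambda> \<longrightarrow>
     A * (\<Sum>n\<in>F. (cmod (a n))\<^sup>2) \<le> L2_norm_sq S (trig_sum F a))"

lemma riesz_lower_boundD: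
  "riesz_lower_bound S \<Lambda> A \<Longrightarrow> finite F \<Longrightarrow> F \<subseteq> \<Lambda> \<Longrightarrow>
     A * (\<Sum>n\<in>F. (cmod (a n))\<^sup>2) \<le> L2_norm_sq S (trig_sum F a)"
  by (simp add: riesz_lower_bound_def)

lemma riesz_lower_bound_mono:
  assumes "riesz_lower_bound S \<Lambda> A" "B \<le> A"
  shows "riesz_lower_bound S \<Lambda> B"
  unfolding riesz_lower_bound_def
proof (intro allI impI)
  fix F a assume "finite F" "F \<subseteq> \<Lambda>"
  have "B * (\<Sum>n\<in>F. (cmod (a n))\<^sup>2) \<le> A * (\<Sum>n\<in>F. (cmod (a n))\<^sup>2)"
    using assms(2) by (intro mult_right_mono sum_nonneg) auto
  also have "\<dots> \<le> L2_norm_sq S (trig_sum F a)"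
    using assms(1) \<open>finite F\<close> \<open>F \<subseteq> \<Lambda>\<close> by (rule riesz_lower_boundD)
  finally show "B * (\<Sum>n\<in>F. (cmod (a n))\<^sup>2) \<le> L2_norm_sq S (trig_sum F a)" .
qed

text \<open>For \<open>S\<close> inside the circle the upper Riesz inequality holds for all integer
  frequencies with constant 2 pi, by Parseval; only the lower constant has to be tracked.\<close>

lemma riesz_sequence_iff:
  assumes "S \<subseteq> circle" "S \<in> sets lebesgue"
  shows "riesz_sequence \<Lambda> S \<longleftrightarrow> (\<exists>A>0. riesz_lower_bound S \<Lambda> A)"
proof
  show "\<exists>A>0. riesz_lower_bound S \<Lambda> A" if "riesz_sequence \<Lambda> S"
    using that unfolding riesz_sequence_def riesz_lower_bound_def trig_sum_def by blast
next
  assume "\<exists>A>0. riesz_lower_bound S \<Lambda> A"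
  then obtain A where "A > 0" "riesz_lower_bound S \<Lambda> A" by blast
  then show "riesz_sequence \<Lambda> S"
    unfolding riesz_sequence_def
    using riesz_lower_boundD[unfolded trig_sum_def]
      L2_norm_sq_le_circle[OF assms, unfolded trig_sum_def]
    by (intro exI[of _ A] conjI exI[of _ "2 * pi"]) auto
qed

text \<open>The coefficients \<open>fourier_int S k\<close> tend to \<open>0\<close>, so a far translate of \<open>E(B)\<close> is almost
  orthogonal to \<open>E(\<Lambda>)\<close> in \<open>L\<^sup>2(S)\<close>.\<close>

lemma riesz_lower_bound_Un_translate:
  assumes S: "S \<subseteq> circle" "S \<in> sets lebesgue" and fin: "finite \<Lambda>" "finite B"
    and \<Lambda>: "riesz_lower_bound S \<Lambda> A" and B: "\<And>M. riesz_lower_bound S ((+) M ` B) A'"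
    and "A \<le> A'" "e > 0"
  shows "\<exists>M. riesz_lower_bound S (\<Lambda> \<union> (+) M ` B) (A - e)"
proof -
  have Sm: "S \<in> lmeasurable" using S by (rule lmeasurable_subset_circle)
  \<comment> \<open>\<open>K\<close> dominates both block sizes, and the summand 1 keeps it
    positive. With cross coefficients at most e/K, the cross term will be at most e/2 times the sum
    of squares.\<close>
  define K where "K = real (card \<Lambda>) + real (card B) + 1"
  define \<eta> where "\<eta> = e / K"
  have K: "K > 0" "real (card \<Lambda>) \<le> K" "real (card B) \<le> K" by (simp_all add: K_def)
  have "\<eta> > 0" using K \<open>e > 0\<close> by (simp add: \<eta>_def)
  define Z where "Z = {k. \<eta> \<le> cmod (fourier_int S k)}"
  have "finite Z" unfolding Z_def using finite_fourier_int_large[OF S \<open>\<eta> > 0\<close>] .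
  \<comment> \<open>The shifts that put some difference \<open>n - (M + b)\<close> into
    \<open>Z\<close>. There are finitely many, so a good integer shift exists.\<close>
  define bad where "bad = (\<lambda>(n,b,z). n - b - z) ` (\<Lambda> \<times> B \<times> Z)"
  have "finite bad" using fin \<open>finite Z\<close> by (auto simp: bad_def)
  then obtain M where M: "M \<notin> bad" using ex_new_if_finite infinite_UNIV_int by blast
  have small: "cmod (fourier_int S (n - (M + b))) \<le> \<eta>" if "n \<in> \<Lambda>" "b \<in> B" for n b
  proof (rule ccontr)
    assume "\<not> ?thesis"
    then have "n - (M + b) \<in> Z" by (simp add: Z_def)
    then have "M \<in> bad" unfolding bad_def using that
      by (intro image_eqI[of _ _ "(n, b, n - (M + b))"]) auto
    with M show False by simp
  qed
  have "riesz_lower_bound S (\<Lambda> \<union> (+) M ` B) (A - e)"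
    unfolding riesz_lower_bound_def
  proof (intro allI impI)
    fix F and a :: "int \<Rightarrow> complex" assume F: "finite F" "F \<subseteq> \<Lambda> \<union> (+) M ` B"
    \<comment> \<open>Taking \<open>F - \<Lambda>\<close> for the second part keeps the split
      disjoint even if the translate meets \<open>\<Lambda>\<close>.\<close>
    define F1 F2 where "F1 = F \<inter> \<Lambda>" and "F2 = F - \<Lambda>"
    have F12: "finite F1" "finite F2" "F1 \<inter> F2 = {}" "F = F1 \<union> F2" "F1 \<subseteq> \<Lambda>" "F2 \<subseteq> (+) M ` B"
      using F by (auto simp: F1_def F2_def)
    define s1 where "s1 = (\<Sum>n\<in>F1. (cmod (a n))\<^sup>2)"
    define s2 where "s2 = (\<Sum>n\<in>F2. (cmod (a n))\<^sup>2)"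
    have nonneg: "s1 \<ge> 0" "s2 \<ge> 0" unfolding s1_def s2_def by (auto intro: sum_nonneg)
    have s: "(\<Sum>n\<in>F. (cmod (a n))\<^sup>2) = s1 + s2"
      unfolding s1_def s2_def using F12 by (simp add: sum.union_disjoint)
    have card1: "real (card F1) \<le> K"
      using card_mono[OF fin(1) F12(5)] K(2) by linarith
    have card2: "real (card F2) \<le> K"
      using card_mono[OF _ F12(6)] card_image_le[OF fin(2), of "(+) M"] fin(2) K(3) by fastforce
    define X where "X = (\<Sum>n\<in>F1. \<Sum>m\<in>F2. a n * cnj (a m) * fourier_int S (n - m))"
    have "cmod X \<le> (\<Sum>n\<in>F1. \<Sum>m\<in>F2. \<eta> * ((cmod (a n))\<^sup>2 + (cmod (a m))\<^sup>2) / 2)"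
      unfolding X_def
    proof (intro sum_norm_le)
      \<comment> \<open>The product of the moduli is at most half the sum of their squares; summing
        then produces only \<open>s1\<close> and \<open>s2\<close>, weighted by the block
        sizes.\<close>
      fix n m assume nm: "n \<in> F1" "m \<in> F2"
      have "cmod (a n * cnj (a m) * fourier_int S (n - m)) \<le> cmod (a n) * cmod (a m) * \<eta>"
        unfolding norm_mult complex_mod_cnj using nm F12(5,6) small[of n]
        by (intro mult_left_mono) auto
      also have "\<dots> \<le> ((cmod (a n))\<^sup>2 + (cmod (a m))\<^sup>2) / 2 * \<eta>"
        using sum_squares_bound[of "cmod (a n)" "cmod (a m)"] \<open>\<eta> > 0\<close>
        by (intro mult_right_mono) auto
      finally show "cmod (a n * cnj (a m) * fourier_int S (n - m)) \<le>
        \<eta> * ((cmod (a n))\<^sup>2 + (cmod (a m))\<^sup>2) / 2" by (simp add: mult_ac)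
    qed
    also have "\<dots> = \<eta> / 2 * (card F2 * s1 + card F1 * s2)"
      by (simp add: s1_def s2_def sum.distrib sum_distrib_left sum_divide_distrib algebra_simps add_divide_distrib)
    also have "\<dots> \<le> \<eta> / 2 * (K * s1 + K * s2)"
      using card1 card2 nonneg \<open>\<eta> > 0\<close> by (intro mult_left_mono add_mono mult_right_mono) auto
    also have "\<dots> = e / 2 * (s1 + s2)" using K by (simp add: \<eta>_def field_simps)
    finally have X: "2 * Re X \<ge> - e * (s1 + s2)"
      using abs_Re_le_cmod[of X] by (simp add: abs_le_iff)
    have "A * s1 \<le> L2_norm_sq S (trig_sum F1 a)"
      unfolding s1_def using \<Lambda> F12 riesz_lower_boundD by blast
    moreover have "A' * s2 \<le> L2_norm_sq S (trig_sum F2 a)"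
      unfolding s2_def using B F12 riesz_lower_boundD by blast
    moreover have "A * s2 \<le> A' * s2" using \<open>A \<le> A'\<close> nonneg by (intro mult_right_mono)
    moreover have "L2_norm_sq S (trig_sum F a) =
        L2_norm_sq S (trig_sum F1 a) + L2_norm_sq S (trig_sum F2 a) + 2 * Re X"
      unfolding X_def F12(4) using F12 by (intro L2_norm_sq_Un[OF Sm]) auto
    ultimately show "(A - e) * (\<Sum>n\<in>F. (cmod (a n))\<^sup>2) \<le> L2_norm_sq S (trig_sum F a)"
      unfolding s using X by (simp add: algebra_simps)
  qed
  then show ?thesis by blast
qed

text \<open>Blocks are attached one at a time, the n-th at a cost of A / 2^(n+2). These costs add up
  to A/2, so every finite stage keeps the bound A/2, and the lower inequality for the union only
  concerns finite subsets.\<close>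

lemma riesz_sequence_Union_translates:
  fixes B :: "nat \<Rightarrow> int set"
  assumes S: "S \<subseteq> circle" "S \<in> sets lebesgue" and fin: "\<And>j. finite (B j)" and "A > 0"
    and B: "\<And>j M. riesz_lower_bound S ((+) M ` B j) A"
  shows "\<exists>M. riesz_sequence (\<Union>j. (+) (M j) ` B j) S"
proof -
  \<comment> \<open>The constants start at \<open>A' 0 = A\<close> and decrease towards A/2. As
    \<open>A' n\<close> is at most \<open>A\<close>, the fresh block is never worse than what has
    been built so far.\<close>
  define A' where "A' n = A * (1 / 2 + 1 / 2 ^ (n + 1))" for n
  have A': "A / 2 \<le> A' n" "A' n \<le> A" "A' n - A / 2 ^ (n + 2) = A' (Suc n)" for n
    using \<open>A > 0\<close> by (simp_all add: A'_def field_simps)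
  define P where "P = (\<lambda>n L. finite L \<and> riesz_lower_bound S L (A' n))"
  have "\<exists>f. \<forall>n. P n (f n) \<and> (\<exists>M. f (Suc n) = f n \<union> (+) M ` B n)"
  proof (rule dependent_nat_choice)
    show "\<exists>L. P 0 L"
      by (rule exI[of _ "{}"]) (auto simp: P_def riesz_lower_bound_def intro: L2_norm_sq_nonneg)
  next
    fix L n assume L: "P n L"
    obtain M where "riesz_lower_bound S (L \<union> (+) M ` B n) (A' n - A / 2 ^ (n + 2))"
      using riesz_lower_bound_Un_translate[OF S _ fin _ B A'(2), of L n "A / 2 ^ (n + 2)" n] L \<open>A > 0\<close>
      by (auto simp: P_def)
    then show "\<exists>L'. P (Suc n) L' \<and> (\<exists>M. L' = L \<union> (+) M ` B n)"
      using L fin by (auto simp: P_def simp flip: A'(3) intro!: exI[of _ "L \<union> (+) M ` B n"])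
  qed
  then obtain f where f: "\<And>n. P n (f n)" "\<And>n. \<exists>M. f (Suc n) = f n \<union> (+) M ` B n" by blast
  then obtain M where M: "\<And>n. f (Suc n) = f n \<union> (+) (M n) ` B n" by metis
  define \<Lambda> where "\<Lambda> = (\<Union>j. (+) (M j) ` B j)"
  have "mono f" by (rule mono_iff_le_Suc[THEN iffD2]) (auto simp: M)
  have "\<Lambda> \<subseteq> (\<Union>n. f n)" unfolding \<Lambda>_def using M by blast
  have "riesz_lower_bound S \<Lambda> (A / 2)"
    unfolding riesz_lower_bound_def
  proof (intro allI impI)
    fix F a assume F: "finite F" "F \<subseteq> \<Lambda>"
    \<comment> \<open>The stages increase, so a finite subset of their union already lies in one of
      them.\<close>
    have "subset.chain UNIV (range f)"
      unfolding subset_chain_def using \<open>mono f\<close> by (metis UNIV_I monoD nle_le rangeE subsetI)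
    then obtain n where "F \<subseteq> f n"
      using finite_subset_Union_chain[OF F(1), of "range f"] F(2) \<open>\<Lambda> \<subseteq> (\<Union>n. f n)\<close> by blast
    moreover have "riesz_lower_bound S (f n) (A / 2)"
      using f(1)[of n] A'(1)[of n] riesz_lower_bound_mono by (auto simp: P_def)
    ultimately show "A / 2 * (\<Sum>n\<in>F. (cmod (a n))\<^sup>2) \<le> L2_norm_sq S (trig_sum F a)"
      using F riesz_lower_boundD by blast
  qed
  then show ?thesis
    unfolding \<Lambda>_def using riesz_sequence_iff[OF S] \<open>A > 0\<close> half_gt_zero by blast
qed

section \<open>Folding the circle\<close>

lemma multiplicity_fun_eq_sum:
  "real (multiplicity_fun l S t) = (\<Sum>j<l. indicat_real S (t + 2 * pi * real j / real l))"
proof -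
  have "(\<Sum>j<l. indicat_real S (t + 2 * pi * real j / real l)) =
    real (card ({..<l} \<inter> {j. t + 2 * pi * real j / real l \<in> S}))"
    by (simp add: indicator_def)
  also have "{..<l} \<inter> {j. t + 2 * pi * real j / real l \<in> S} =
     {j. j < l \<and> t + 2 * pi * real j / real l \<in> S}" by auto
  finally show ?thesis by (simp add: multiplicity_fun_def)
qed

lemma multiplicity_fun_le: "multiplicity_fun l S t \<le> l"
proof -
  have "multiplicity_fun l S t \<le> card {..<l}"
    unfolding multiplicity_fun_def by (rule card_mono) auto
  then show ?thesis by simp
qed

lemma indicator_affine_measurable:
  assumes "S \<in> sets lebesgue" "c \<noteq> 0"
  shows "(\<lambda>s::real. indicat_real S (t + c * s)) \<in> borel_measurable lebesgue"
proof -
  have "indicat_real S \<in> borel_measurable lebesgue"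
    using assms(1) by (rule borel_measurable_indicator)
  from borel_measurable_affine[OF this assms(2), of t] show ?thesis by simp
qed

lemma multiplicity_fun_measurable:
  assumes "S \<in> sets lebesgue" "l \<ge> 1"
  shows "(\<lambda>t. real (multiplicity_fun l S (t / real l))) \<in> borel_measurable lebesgue"
proof -
  have "(\<lambda>t. indicat_real S (t / real l + 2 * pi * real j / real l)) \<in> borel_measurable lebesgue" for j
    using indicator_affine_measurable[OF assms(1), of "1 / real l" "2 * pi * real j / real l"] assms(2)
    by (simp add: add.commute)
  then show ?thesis unfolding multiplicity_fun_eq_sum by measurable
qed

lemma low_multiplicity_set_measurable:
  assumes "S \<in> sets lebesgue" "l \<ge> 1"
  shows "low_multiplicity_set \<delta> l S \<in> lmeasurable"
proof (rule lmeasurable_subset_circle)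
  have "low_multiplicity_set \<delta> l S =
     {t \<in> space lebesgue. real (multiplicity_fun l S (t / real l)) < \<delta> * real l} \<inter> circle"
    by (auto simp: low_multiplicity_set_def)
  also have "\<dots> \<in> sets lebesgue"
    by (intro sets.Int borel_measurable_less multiplicity_fun_measurable[OF assms] borel_measurable_const
        fmeasurableD[OF circle_lmeasurable])
  finally show "low_multiplicity_set \<delta> l S \<in> sets lebesgue" .
qed (auto simp: low_multiplicity_set_def)

text \<open>Half-open fundamental domains tile the longer interval exactly, with no endpoint counted
  twice.\<close>

lemma sum_indicator_circle_translates:
  "(\<Sum>j<l. indicat_real circle (s - 2 * pi * real j)) = indicat_real {0..<2 * pi * real l} s"
proof (induction l)
  case (Suc l)
  have eq: "{0..<2 * pi * real (Suc l)} = {0..<2 * pi * real l} \<union> {2 * pi * real l..<2 * pi * real (Suc l)}"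
    by (intro ivl_disj_un_two(3)[symmetric]) auto
  have "indicat_real {0..<2 * pi * real (Suc l)} s =
    indicat_real {0..<2 * pi * real l} s + indicat_real {2 * pi * real l..<2 * pi * real (Suc l)} s"
    unfolding eq by (rule indicator_disj_union) auto
  also have "indicat_real {2 * pi * real l..<2 * pi * real (Suc l)} s = indicat_real circle (s - 2 * pi * real l)"
    by (simp add: indicator_def circle_def algebra_simps)
  finally show ?case using Suc by simp
qed simp

lemma periodic_of_nat:
  fixes h :: "real \<Rightarrow> 'a"
  assumes "\<And>s. h (s + 2 * pi) = h s"
  shows "h (s + 2 * pi * real j) = h s"
proof (induction j)
  case (Suc j)
  then show ?case using assms[of "s + 2 * pi * real j"] by (simp add: algebra_simps)
qed simp

text \<open>Substituting s = l t stretches \<open>S\<close> into [0, 2 pi l). Cut this into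
  \<open>l\<close> periods and shift each back to the circle: periodicity leaves \<open>h\<close>
  unchanged, and the shifted indicators of \<open>S\<close> add up to the multiplicity.\<close>

lemma set_integral_periodic_dilate:
  fixes h :: "real \<Rightarrow> real"
  assumes S: "S \<subseteq> circle" "S \<in> sets lebesgue" and l: "l \<ge> 1"
    and h: "h \<in> borel_measurable lebesgue" "\<And>s. \<bar>h s\<bar> \<le> K" "\<And>s. h (s + 2 * pi) = h s"
  shows "(LINT t:S|lebesgue. h (real l * t)) =
    (LINT s:circle|lebesgue. h s * real (multiplicity_fun l S (s / real l))) / real l"
proof -
  have int: "integrable lebesgue (\<lambda>u. indicat_real circle u * (indicat_real S (u / real l + 2 * pi * real j / real l) * h u))" for j
  proof -
    have "set_integrable lebesgue circle (\<lambda>u. indicat_real S (u / real l + 2 * pi * real j / real l) * h u)"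
    proof (rule set_integrable_bounded[OF circle_lmeasurable, where B = K])
      show "(\<lambda>u. indicat_real S (u / real l + 2 * pi * real j / real l) * h u) \<in> borel_measurable lebesgue"
        using indicator_affine_measurable[OF S(2), of "1 / real l" "2 * pi * real j / real l"] l h(1)
        by (simp add: add.commute)
      show "norm (indicat_real S (u / real l + 2 * pi * real j / real l) * h u) \<le> K" for u
        using h(2)[of u] by (auto simp: indicator_def)
    qed
    then show ?thesis by (simp add: set_integrable_def)
  qed
  \<comment> \<open>The redundant factor in \<open>1 * u\<close> matches the affine change of
    variables with slope 1 and offset \<open>2 * pi * real j\<close>.\<close>
  have aff: "indicat_real circle (2 * pi * real j + 1 * u - 2 * pi * real j) *
      (indicat_real S ((2 * pi * real j + 1 * u) / real l) * h (2 * pi * real j + 1 * u)) =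
      indicat_real circle u * (indicat_real S (u / real l + 2 * pi * real j / real l) * h u)" for u j
    using periodic_of_nat[of h u j] h(3) by (simp add: add_divide_distrib add.commute)
  have int': "integrable lebesgue (\<lambda>s. indicat_real circle (s - 2 * pi * real j) * (indicat_real S (s / real l) * h s))" for j
    using int[of j] lebesgue_integrable_real_affine_iff[of 1
        "\<lambda>s. indicat_real circle (s - 2 * pi * real j) * (indicat_real S (s / real l) * h s)" "2 * pi * real j"]
    unfolding aff by simp
  have "(LINT t:S|lebesgue. h (real l * t)) = (\<integral>t. indicat_real S t * h (real l * t) \<partial>lebesgue)"
    by (simp add: set_lebesgue_integral_def)
  also have "\<dots> = (\<integral>s. indicat_real S (s / real l) * h s \<partial>lebesgue) / real l"
    using l by (subst lebesgue_integral_real_affine[of "1 / real l" _ 0]) auto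
  also have "(\<lambda>s. indicat_real S (s / real l) * h s) =
    (\<lambda>s. \<Sum>j<l. indicat_real circle (s - 2 * pi * real j) * (indicat_real S (s / real l) * h s))"
  proof
    fix s
    \<comment> \<open>As \<open>S\<close> lies in the circle, its dilate lies in [0, 2 pi l), so
      inserting the tiling changes nothing.\<close>
    have "indicat_real S (s / real l) = indicat_real {0..<2 * pi * real l} s * indicat_real S (s / real l)"
      using S(1) l by (auto simp: indicator_def circle_def field_simps)
    then show "indicat_real S (s / real l) * h s =
      (\<Sum>j<l. indicat_real circle (s - 2 * pi * real j) * (indicat_real S (s / real l) * h s))"
      unfolding sum_distrib_right[symmetric] sum_indicator_circle_translates by (metis mult.assoc)
  qed
  also have "(\<integral>s. (\<Sum>j<l. indicat_real circle (s - 2 * pi * real j) * (indicat_real S (s / real l) * h s)) \<partial>lebesgue) =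
     (\<Sum>j<l. \<integral>s. indicat_real circle (s - 2 * pi * real j) * (indicat_real S (s / real l) * h s) \<partial>lebesgue)"
    using int' by (rule Bochner_Integration.integral_sum)
  also have "\<dots> = (\<Sum>j<l. \<integral>u. indicat_real circle u * (indicat_real S (u / real l + 2 * pi * real j / real l) * h u) \<partial>lebesgue)"
  proof (rule sum.cong[OF refl])
    fix j
    show "(\<integral>s. indicat_real circle (s - 2 * pi * real j) * (indicat_real S (s / real l) * h s) \<partial>lebesgue) =
      (\<integral>u. indicat_real circle u * (indicat_real S (u / real l + 2 * pi * real j / real l) * h u) \<partial>lebesgue)"
      by (subst lebesgue_integral_real_affine[of 1 _ "2 * pi * real j"]) (simp_all only: aff, simp_all)
  qed
  also have "\<dots> = (\<integral>u. (\<Sum>j<l. indicat_real circle u * (indicat_real S (u / real l + 2 * pi * real j / real l) * h u)) \<partial>lebesgue)"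
    using int by (rule Bochner_Integration.integral_sum[symmetric])
  also have "\<dots> = (LINT s:circle|lebesgue. h s * real (multiplicity_fun l S (s / real l)))"
    unfolding set_lebesgue_integral_def multiplicity_fun_eq_sum
    by (simp only: sum_distrib_left real_scaleR_def) (simp only: mult_ac)
  finally show ?thesis .
qed

section \<open>Trigonometric sums along an arithmetic progression\<close>

lemma trig_sum_periodic: "trig_sum F a (s + 2 * pi) = trig_sum F a s"
proof -
  have "exp (\<i> * of_int n * of_real (s + 2 * pi)) = exp (\<i> * of_int n * of_real s)" for n
    using exp_integer_2pi[of "of_int n"] by (simp add: algebra_simps exp_add)
  then show ?thesis by (simp add: trig_sum_def)
qed

lemma inj_progression: "l \<ge> 1 \<Longrightarrow> inj_on (\<lambda>k. M + k * int l) G"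
  by (auto simp: inj_on_def)

text \<open>The offset \<open>M\<close> only contributes a unimodular factor. Hence all bounds for
  progressions are uniform in \<open>M\<close>, as the gluing of translates requires.\<close>

lemma norm_trig_sum_progression:
  assumes "l \<ge> 1"
  shows "cmod (trig_sum ((\<lambda>k. M + k * int l) ` G) a t) =
     cmod (trig_sum G (\<lambda>k. a (M + k * int l)) (real l * t))"
proof -
  have "trig_sum ((\<lambda>k. M + k * int l) ` G) a t =
    exp (\<i> * of_int M * of_real t) * trig_sum G (\<lambda>k. a (M + k * int l)) (real l * t)"
    unfolding trig_sum_def sum.reindex[OF inj_progression[OF assms]] sum_distrib_left o_def
    by (intro sum.cong) (auto simp: algebra_simps simp flip: exp_add)
  then show ?thesis by (simp add: norm_mult)
qed

lemma L2_norm_sq_progression: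
  assumes S: "S \<subseteq> circle" "S \<in> sets lebesgue" and l: "l \<ge> 1"
  shows "L2_norm_sq S (trig_sum ((\<lambda>k. M + k * int l) ` G) a) =
    (LINT s:circle|lebesgue. (cmod (trig_sum G (\<lambda>k. a (M + k * int l)) s))\<^sup>2
        * real (multiplicity_fun l S (s / real l))) / real l"
  unfolding L2_norm_sq_def norm_trig_sum_progression[OF l]
  by (rule set_integral_periodic_dilate[OF S l, where K = "real (card G) * (\<Sum>n\<in>G. (cmod (a (M + n * int l)))\<^sup>2)"])
     (use norm_trig_sum_sq_le trig_sum_periodic in auto)

lemma multiplicity_product_integrable:
  assumes "S \<in> sets lebesgue" "l \<ge> 1"
  shows "set_integrable lebesgue circle
    (\<lambda>s. (cmod (trig_sum G b s))\<^sup>2 * real (multiplicity_fun l S (s / real l)))"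
proof (rule set_integrable_bounded[OF circle_lmeasurable])
  show "norm ((cmod (trig_sum G b s))\<^sup>2 * real (multiplicity_fun l S (s / real l))) \<le>
    (real (card G) * (\<Sum>n\<in>G. (cmod (b n))\<^sup>2)) * real l" for s
    using multiplicity_fun_le[of l S "s / real l"] norm_trig_sum_sq_le[of G b s]
    by (simp add: abs_mult) (intro mult_mono; simp add: sum_nonneg)
qed (use multiplicity_fun_measurable[OF assms] in measurable)

text \<open>After folding, the weight is at least \<delta> l off the low-multiplicity set, and on
  that set |P|^2 is at most N T, where T is the sum of squared coefficients. The loss is thus at
  most \<delta> T, against a main term 2 pi \<delta> T.\<close>

lemma riesz_lower_bound_progression:
  assumes S: "S \<subseteq> circle" "S \<in> sets lebesgue" and l: "l \<ge> 1" and "0 < \<delta>"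
    and N: "real N * measure lebesgue (low_multiplicity_set \<delta> l S) \<le> 1"
  shows "riesz_lower_bound S ((\<lambda>k. M + int k * int l) ` {1..N}) \<delta>"
  unfolding riesz_lower_bound_def
proof (intro allI impI)
  fix F and a :: "int \<Rightarrow> complex" assume F: "finite F" "F \<subseteq> (\<lambda>k. M + int k * int l) ` {1..N}"
  define L where "L = low_multiplicity_set \<delta> l S"
  have Lm: "L \<in> lmeasurable" unfolding L_def using low_multiplicity_set_measurable S l by blast
  have Lc: "L \<subseteq> circle" by (auto simp: L_def low_multiplicity_set_def)
  \<comment> \<open>The multipliers of the frequencies in \<open>F\<close>. As \<open>G\<close> lies
    in the image of \<open>{1..N}\<close>, its size is at most \<open>N\<close> whichever subset
    \<open>F\<close> is tested.\<close>
  define G where "G = {k \<in> int ` {1..N}. M + k * int l \<in> F}"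
  have FG: "F = (\<lambda>k. M + k * int l) ` G"
  proof
    show "F \<subseteq> (\<lambda>k. M + k * int l) ` G"
    proof
      fix n assume "n \<in> F"
      moreover from this F(2) obtain k where "k \<in> {1..N}" "n = M + int k * int l" by blast
      ultimately show "n \<in> (\<lambda>k. M + k * int l) ` G" by (auto simp: G_def)
    qed
  qed (auto simp: G_def)
  have G: "finite G" by (simp add: G_def)
  have "card G \<le> card (int ` {1..N})" unfolding G_def by (intro card_mono) auto
  then have cG: "card G \<le> N" by (simp add: card_image)
  define b where "b = (\<lambda>k. a (M + k * int l))"
  define T where "T = (\<Sum>k\<in>G. (cmod (b k))\<^sup>2)"
  have "T \<ge> 0" by (simp add: T_def sum_nonneg)
  have FT: "(\<Sum>n\<in>F. (cmod (a n))\<^sup>2) = T"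
    unfolding FG T_def b_def by (simp add: sum.reindex[OF inj_progression[OF l]])
  have bound: "(cmod (trig_sum G b s))\<^sup>2 \<le> N * T" for s
    using norm_trig_sum_sq_le[of G b s] cG \<open>T \<ge> 0\<close> unfolding T_def[symmetric]
    by (meson mult_right_mono of_nat_le_iff order_trans)
  have int1: "set_integrable lebesgue circle (\<lambda>s. (cmod (trig_sum G b s))\<^sup>2)"
    by (rule norm_trig_sum_sq_integrable[OF circle_lmeasurable])
  have int2: "set_integrable lebesgue circle (\<lambda>s. indicat_real L s)"
    by (rule set_integrable_bounded[OF circle_lmeasurable, where B = 1])
       (use Lm in \<open>auto simp: indicator_def fmeasurableD\<close>)
  \<comment> \<open>On \<open>L\<close> the left integrand is nonpositive by the bound N T; off
    \<open>L\<close> it is the lower bound given by the multiplicity.\<close>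
  have "(LINT s:circle|lebesgue. \<delta> * real l * (cmod (trig_sum G b s))\<^sup>2 - \<delta> * real l * (N * T) * indicat_real L s)
     \<le> (LINT s:circle|lebesgue. (cmod (trig_sum G b s))\<^sup>2 * real (multiplicity_fun l S (s / real l)))"
  proof (rule set_integral_mono)
    fix s assume s: "s \<in> circle"
    show "\<delta> * real l * (cmod (trig_sum G b s))\<^sup>2 - \<delta> * real l * (N * T) * indicat_real L s
      \<le> (cmod (trig_sum G b s))\<^sup>2 * real (multiplicity_fun l S (s / real l))"
    proof (cases "s \<in> L")
      case True
      have "\<delta> * real l * (cmod (trig_sum G b s))\<^sup>2 \<le> \<delta> * real l * (N * T)"
        using bound \<open>0 < \<delta>\<close> by (intro mult_left_mono) auto
      then have "\<delta> * real l * (cmod (trig_sum G b s))\<^sup>2 - \<delta> * real l * (N * T) * indicat_real L s \<le> 0"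
        using True by simp
      also have "0 \<le> (cmod (trig_sum G b s))\<^sup>2 * real (multiplicity_fun l S (s / real l))" by simp
      finally show ?thesis .
    next
      case False
      then have "\<delta> * real l \<le> real (multiplicity_fun l S (s / real l))"
        using s by (auto simp: L_def low_multiplicity_set_def)
      then have "\<delta> * real l * (cmod (trig_sum G b s))\<^sup>2 \<le>
          real (multiplicity_fun l S (s / real l)) * (cmod (trig_sum G b s))\<^sup>2"
        by (rule mult_right_mono) simp
      then show ?thesis using False by (simp add: mult.commute)
    qed
  qed (use int1 int2 multiplicity_product_integrable[OF S(2) l] in auto)
  also have "(LINT s:circle|lebesgue. \<delta> * real l * (cmod (trig_sum G b s))\<^sup>2 - \<delta> * real l * (N * T) * indicat_real L s)
    = \<delta> * real l * (LINT s:circle|lebesgue. (cmod (trig_sum G b s))\<^sup>2)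
      - \<delta> * real l * (N * T) * (LINT s:circle|lebesgue. indicat_real L s)"
    using int1 int2 by (subst set_integral_diff(2)) auto
  also have "(LINT s:circle|lebesgue. indicat_real L s) = measure lebesgue L"
    using Lm Lc by (simp add: set_lebesgue_integral_def inf_absorb2 fmeasurableD flip: indicator_inter_arith)
  also have "(LINT s:circle|lebesgue. (cmod (trig_sum G b s))\<^sup>2) = 2 * pi * T"
    using L2_norm_sq_circle[OF G, of b] by (simp add: L2_norm_sq_def T_def)
  finally have "\<delta> * real l * (2 * pi * T) - \<delta> * real l * (N * T) * measure lebesgue L
    \<le> real l * L2_norm_sq S (trig_sum F a)"
    unfolding FG L2_norm_sq_progression[OF S l] using l by (simp add: b_def)
  then have "real l * (\<delta> * (2 * pi * T) - \<delta> * T * (N * measure lebesgue L)) \<le> real l * L2_norm_sq S (trig_sum F a)"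
    by (simp add: algebra_simps)
  then have "\<delta> * (2 * pi * T) - \<delta> * T * (N * measure lebesgue L) \<le> L2_norm_sq S (trig_sum F a)"
    using l by simp
  moreover have "\<delta> * T * (N * measure lebesgue L) \<le> \<delta> * T * 1"
    using N \<open>0 < \<delta>\<close> \<open>T \<ge> 0\<close> unfolding L_def by (intro mult_left_mono) auto
  moreover have "\<delta> * T * 2 \<le> \<delta> * T * (2 * pi)"
    using \<open>0 < \<delta>\<close> \<open>T \<ge> 0\<close> pi_ge_two by (intro mult_left_mono) auto
  ultimately show "\<delta> * (\<Sum>n\<in>F. (cmod (a n))\<^sup>2) \<le> L2_norm_sq S (trig_sum F a)"
    unfolding FT by (simp add: algebra_simps)
qed

section \<open>Sufficiency\<close>

text \<open>One block is taken for each length in \<open>W\<close>. Every translate of every block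
  has the same lower bound \<delta>, so the blocks can be glued into one Riesz sequence that
  contains all the required progressions.\<close>

lemma class_A_if_progressions:
  assumes S: "S \<subseteq> circle" "S \<in> sets lebesgue" and "\<delta> > 0" "C > 0"
    and inf: "infinite W"
    and W: "\<And>N. N \<in> W \<Longrightarrow> N \<ge> 1 \<and> (\<exists>l::nat. l \<ge> 1 \<and> real l \<le> C * real N powr \<alpha> \<and>
               real N * measure lebesgue (low_multiplicity_set \<delta> l S) \<le> 1)"
  shows "S \<in> class_A \<alpha>"
proof -
  obtain l :: "nat \<Rightarrow> nat" where l: "\<And>N. N \<in> W \<Longrightarrow> l N \<ge> 1 \<and> real (l N) \<le> C * real N powr \<alpha> \<and>
               real N * measure lebesgue (low_multiplicity_set \<delta> (l N) S) \<le> 1"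
    using W by metis
  define f where "f = enumerate W"
  have f: "f j \<in> W" for j using enumerate_in_set[OF inf] by (simp add: f_def)
  define B where "B = (\<lambda>j. (\<lambda>k. int k * int (l (f j))) ` {1..f j})"
  have B: "(+) M ` B j = (\<lambda>k. M + int k * int (l (f j))) ` {1..f j}" for M j
    by (simp add: B_def image_image)
  obtain M where M: "riesz_sequence (\<Union>j. (+) (M j) ` B j) S"
  proof -
    have "riesz_lower_bound S ((+) M ` B j) \<delta>" for j M
      unfolding B using l[OF f] by (intro riesz_lower_bound_progression[OF S _ \<open>\<delta> > 0\<close>]) auto
    then show ?thesis
      using riesz_sequence_Union_translates[OF S _ \<open>\<delta> > 0\<close>, of B] that by (auto simp: B_def)
  qed
  define X where "X = {N :: nat. N \<ge> 1 \<and> (\<exists>(M' :: int) (l :: nat). l \<ge> 1 \<and> real l \<le> C * real N powr \<alpha> \<and>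
             (\<lambda>k. M' + int k * int l) ` {1..N} \<subseteq> (\<Union>j. (+) (M j) ` B j))}"
  have "W \<subseteq> X"
  proof
    fix N assume N: "N \<in> W"
    then obtain j where j: "f j = N" unfolding f_def using enumerate_Ex[OF inf N] by blast
    have "(\<lambda>k. M j + int k * int (l N)) ` {1..N} \<subseteq> (\<Union>j. (+) (M j) ` B j)"
      using B[of "M j" j] unfolding j by blast
    then show "N \<in> X" using l[OF N] W[OF N] unfolding X_def by blast
  qed
  then have "infinite X" using inf finite_subset by blast
  then show ?thesis unfolding class_A_def X_def using S M \<open>C > 0\<close> by blast
qed

lemma multiplicity_condition_imp_class_A:
  assumes S: "S \<subseteq> circle" "S \<in> sets lebesgue" and \<alpha>: "0 \<le> \<alpha>" "\<alpha> \<le> 1"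
    and "multiplicity_condition \<alpha> S"
  shows "S \<in> class_A \<alpha>"
proof -
  obtain c \<delta> where c: "0 < c" "c < 1" "0 < \<delta>" and inf: "infinite {l :: nat. l \<ge> 1 \<and>
          (if \<alpha> = 0 then measure lebesgue (low_multiplicity_set \<delta> l S) = 0
           else measure lebesgue (low_multiplicity_set \<delta> l S) < c / real l powr (1 / \<alpha>))}"
    (is "infinite ?L")
    using assms(5) unfolding multiplicity_condition_def by blast
  show ?thesis
  proof (cases "\<alpha> = 0")
    case True
    \<comment> \<open>A single good step serves all lengths: the exceptional set is null, and
      \<open>real N powr 0 = 1\<close> for positive \<open>N\<close>, so \<open>C = real l\<close>
      works.\<close>
    obtain l where "l \<in> ?L" using inf not_finite_existsD by blast
    then have l: "l \<ge> 1" "measure lebesgue (low_multiplicity_set \<delta> l S) = 0" using True by auto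
    show ?thesis
    proof (rule class_A_if_progressions[OF S \<open>0 < \<delta>\<close>, of "real l" "{1..}"])
      show "N \<ge> 1 \<and> (\<exists>l'\<ge>1. real l' \<le> real l * real N powr \<alpha> \<and>
        real N * measure lebesgue (low_multiplicity_set \<delta> l' S) \<le> 1)" if "N \<in> {1..}" for N
        using that l True by (intro conjI exI[of _ l]) auto
    qed (use l infinite_Ici in auto)
  next
    case False
    then have "\<alpha> > 0" using \<alpha> by simp
    \<comment> \<open>The length of the progression of step \<open>l\<close>. Since 1/\<alpha> is at
      least 1, \<open>g l\<close> is at least \<open>l\<close>, so the lengths are unbounded.
      Rounding down a number that is at least 1 loses at most a factor 2, which gives the constant 2
      below.\<close>
    define g where "g = (\<lambda>l::nat. nat \<lfloor>real l powr (1 / \<alpha>)\<rfloor>)"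
    have g_ge: "l \<le> g l" if "l \<ge> 1" for l
    proof -
      have "real l powr 1 \<le> real l powr (1 / \<alpha>)"
        using that \<alpha> \<open>\<alpha> > 0\<close> by (intro powr_mono) auto
      then show ?thesis using that by (simp add: g_def le_nat_floor)
    qed
    have g_le: "real (g l) \<le> real l powr (1 / \<alpha>)" for l
      unfolding g_def by (rule of_nat_floor) simp
    have le_g: "real l powr (1 / \<alpha>) \<le> 2 * real (g l)" if "l \<ge> 1" for l
      using g_ge[OF that] that unfolding g_def by linarith
    show ?thesis
    proof (rule class_A_if_progressions[OF S \<open>0 < \<delta>\<close>, of 2 "g ` ?L"])
      show "infinite (g ` ?L)"
        unfolding infinite_nat_iff_unbounded_le
      proof
        fix m
        obtain l where "m \<le> l" "l \<in> ?L" using inf unfolding infinite_nat_iff_unbounded_le by blast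
        moreover from this have "l \<le> g l" by (intro g_ge) simp
        ultimately show "\<exists>n\<ge>m. n \<in> g ` ?L" by (meson image_eqI le_trans)
      qed
    next
      fix N assume "N \<in> g ` ?L"
      then obtain l where l: "l \<ge> 1" "N = g l"
        "measure lebesgue (low_multiplicity_set \<delta> l S) < c / real l powr (1 / \<alpha>)"
        using False by auto
      have "N \<ge> 1" using g_ge[OF l(1)] l by simp
      have "real l = (real l powr (1 / \<alpha>)) powr \<alpha>" using l \<open>\<alpha> > 0\<close> by (simp add: powr_powr)
      also have "\<dots> \<le> (2 * real N) powr \<alpha>" using le_g[OF l(1)] l \<open>\<alpha> > 0\<close> by (intro powr_mono2) auto
      also have "\<dots> = 2 powr \<alpha> * real N powr \<alpha>" by (simp add: powr_mult)
      also have "\<dots> \<le> 2 powr 1 * real N powr \<alpha>" using \<alpha> by (intro mult_right_mono powr_mono) auto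
      finally have 1: "real l \<le> 2 * real N powr \<alpha>" by simp
      have "real N * measure lebesgue (low_multiplicity_set \<delta> l S) \<le>
         real l powr (1 / \<alpha>) * (c / real l powr (1 / \<alpha>))"
        using l g_le[of l] by (intro mult_mono) auto
      also have "\<dots> \<le> 1" using c l by simp
      finally show "N \<ge> 1 \<and> (\<exists>l\<ge>1. real l \<le> 2 * real N powr \<alpha> \<and>
        real N * measure lebesgue (low_multiplicity_set \<delta> l S) \<le> 1)"
        using 1 l \<open>N \<ge> 1\<close> by blast
    qed simp
  qed
qed

section \<open>Necessity\<close>

text \<open>On the unit circle \<open>Re z\<close> and \<open>Im z\<close> are Laurent polynomials in \<open>z\<close>; the factor \<open>z ^ n\<close> clears
  the denominator and has modulus \<open>1\<close>.\<close>

lemma real_polynomial_on_sphere: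
  assumes "real_polynomial_function (g :: complex \<Rightarrow> real)"
  shows "\<exists>n q. \<forall>z. cmod z = 1 \<longrightarrow> of_real (g z) * z ^ n = poly q z"
  using assms
proof (induction rule: real_polynomial_function.induct)
  case (linear f)
  \<comment> \<open>For |z| = 1 one has Re z * z = (z^2 + 1)/2 and Im z * z = -i (z^2 - 1)/2; the
    displayed coefficients combine these with weights \<open>f 1\<close> and
    \<open>f \<i>\<close>.\<close>
  interpret f: bounded_linear f by fact
  have "of_real (f z) * z ^ 1 = poly [: (of_real (f 1) + \<i> * of_real (f \<i>)) / 2, 0,
      (of_real (f 1) - \<i> * of_real (f \<i>)) / 2 :] z" if z: "cmod z = 1" for z
  proof -
    have "f z = f (Re z *\<^sub>R 1 + Im z *\<^sub>R \<i>)"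
      using complex_eq[of z] by (simp add: scaleR_conv_of_real mult.commute)
    then have fz: "f z = Re z * f 1 + Im z * f \<i>" by (simp add: f.add f.scale)
    have zz: "z * cnj z = 1" using z complex_norm_square[of z] by simp
    have re: "of_real (Re z) = (z + cnj z) / 2" and im: "of_real (Im z) = - \<i> * (z - cnj z) / 2"
      by (simp_all add: complex_eq_iff)
    have "of_real (Re z) * z = (z\<^sup>2 + 1) / 2" "of_real (Im z) * z = - \<i> * (z\<^sup>2 - 1) / 2"
      unfolding re im using zz by (simp_all add: algebra_simps power2_eq_square)
    then have "of_real (f z) * z = (z\<^sup>2 + 1) / 2 * of_real (f 1) + - \<i> * (z\<^sup>2 - 1) / 2 * of_real (f \<i>)"
      unfolding fz of_real_add of_real_mult distrib_right by (metis mult.assoc mult.commute)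
    then show ?thesis by (simp add: field_simps power2_eq_square)
  qed
  then show ?case by blast
next
  case (const c)
  show ?case by (intro exI[of _ 0] exI[of _ "[:of_real c:]"]) simp
next
  case (add f g)
  then obtain n p m q where "\<And>z. cmod z = 1 \<Longrightarrow> of_real (f z) * z ^ n = poly p z"
    "\<And>z. cmod z = 1 \<Longrightarrow> of_real (g z) * z ^ m = poly q z" by blast
  \<comment> \<open>Both summands are brought to the common power n + m, hence the crossed
    monomials.\<close>
  then show ?case
    by (intro exI[of _ "n + m"] exI[of _ "p * monom 1 m + q * monom 1 n"])
       (simp add: poly_monom power_add algebra_simps)
next
  case (mult f g)
  then obtain n p m q where fg: "\<And>z. cmod z = 1 \<Longrightarrow> of_real (f z) * z ^ n = poly p z"
    "\<And>z. cmod z = 1 \<Longrightarrow> of_real (g z) * z ^ m = poly q z" by blast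
  have "of_real (f z * g z) * z ^ (n + m) = poly (p * q) z" if "cmod z = 1" for z
    by (simp add: power_add mult_ac flip: fg[OF that])
  then show ?case by blast
qed

text \<open>Progressions start at multiplier 1, so the coefficient of index k - 1 sits at frequency
  k; the resulting extra factor \<open>cis t\<close> has modulus 1.\<close>

lemma cmod_trig_sum_poly:
  assumes "degree q < N"
  shows "cmod (trig_sum (int ` {1..N}) (\<lambda>k. coeff q (nat k - 1)) t) = cmod (poly q (cis t))"
proof -
  have "trig_sum (int ` {1..N}) (\<lambda>k. coeff q (nat k - 1)) t =
      (\<Sum>k\<in>{1..N}. coeff q (k - 1) * cis t ^ k)"
    unfolding trig_sum_def by (subst sum.reindex) (auto simp: cis_conv_exp exp_of_nat_mult[symmetric] mult_ac)
  also have "\<dots> = (\<Sum>k<N. coeff q k * cis t ^ Suc k)"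
    by (rule sum.reindex_bij_witness[of _ Suc "\<lambda>k. k - 1"]) auto
  also have "\<dots> = cis t * (\<Sum>k<N. coeff q k * cis t ^ k)"
    by (simp add: sum_distrib_left mult_ac)
  also have "(\<Sum>k<N. coeff q k * cis t ^ k) = (\<Sum>k\<le>degree q. coeff q k * cis t ^ k)"
    using assms by (intro sum.mono_neutral_right) (auto simp: coeff_eq_0)
  finally show ?thesis by (simp add: poly_altdef norm_mult)
qed

text \<open>On the unit circle the square of a real polynomial is |P|^2 for a trigonometric sum P
  with frequencies 1 to N. The Riesz bound along a progression of length N, with Parseval for the
  sum of squares, then compares the multiplicity with a constant weight.\<close>

lemma weighted_integral_real_polynomial:
  assumes S: "S \<subseteq> circle" "S \<in> sets lebesgue" and l: "l \<ge> 1"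
    and \<Lambda>: "riesz_lower_bound S \<Lambda> A"
    and prog: "\<And>N. \<exists>M. (\<lambda>k. M + int k * int l) ` {1..N} \<subseteq> \<Lambda>"
    and g: "real_polynomial_function (g :: complex \<Rightarrow> real)"
  shows "A / (2 * pi) * real l * (LINT s:circle|lebesgue. (g (cis s))\<^sup>2)
     \<le> (LINT s:circle|lebesgue. (g (cis s))\<^sup>2 * real (multiplicity_fun l S (s / real l)))"
proof -
  obtain n q where q: "\<And>z. cmod z = 1 \<Longrightarrow> of_real (g z) * z ^ n = poly q z"
    using real_polynomial_on_sphere[OF g] by blast
  define N where "N = Suc (degree q)"
  obtain M where M: "(\<lambda>k. M + int k * int l) ` {1..N} \<subseteq> \<Lambda>" using prog by blast
  define G where "G = int ` {1..N}"
  have "finite G" by (simp add: G_def)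
  define b where "b = (\<lambda>k. coeff q (nat k - 1))"
  \<comment> \<open>Undoes the reindexing of the progression, so that \<open>b\<close> becomes its
    sequence of coefficients.\<close>
  define a where "a = (\<lambda>m. b ((m - M) div int l))"
  have ab: "(\<lambda>k. a (M + k * int l)) = b" using l by (auto simp: a_def)
  have trig: "(cmod (trig_sum G b s))\<^sup>2 = (g (cis s))\<^sup>2" for s
  proof -
    have "cmod (trig_sum G b s) = cmod (of_real (g (cis s)) * cis s ^ n)"
      unfolding G_def b_def by (subst cmod_trig_sum_poly) (auto simp: N_def q)
    then show ?thesis by (simp add: norm_mult norm_power)
  qed
  have "(\<Sum>m\<in>(\<lambda>k. M + k * int l) ` G. (cmod (a m))\<^sup>2) = (\<Sum>k\<in>G. (cmod (b k))\<^sup>2)"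
    using ab by (simp add: sum.reindex[OF inj_progression[OF l]] fun_eq_iff)
  then have "A * (\<Sum>k\<in>G. (cmod (b k))\<^sup>2) \<le> L2_norm_sq S (trig_sum ((\<lambda>k. M + k * int l) ` G) a)"
    using riesz_lower_boundD[OF \<Lambda>, of "(\<lambda>k. M + k * int l) ` G" a] M \<open>finite G\<close>
    by (simp add: G_def image_image)
  also have "\<dots> = (LINT s:circle|lebesgue. (g (cis s))\<^sup>2 * real (multiplicity_fun l S (s / real l))) / real l"
    unfolding L2_norm_sq_progression[OF S l] ab trig ..
  finally have "real l * (A * (\<Sum>k\<in>G. (cmod (b k))\<^sup>2)) \<le>
      (LINT s:circle|lebesgue. (g (cis s))\<^sup>2 * real (multiplicity_fun l S (s / real l)))"
    using l by (simp add: field_simps)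
  moreover have "(\<Sum>k\<in>G. (cmod (b k))\<^sup>2) = (LINT s:circle|lebesgue. (g (cis s))\<^sup>2) / (2 * pi)"
    using L2_norm_sq_circle[OF \<open>finite G\<close>, of b] unfolding L2_norm_sq_def trig by simp
  ultimately show ?thesis by (simp add: field_simps)
qed

text \<open>Regularity of Lebesgue measure traps most of \<open>E\<close> between a compact
  \<open>K\<close> and a slightly larger open \<open>U\<close>; Urysohn's lemma is applied to their
  images under \<open>cis\<close>, so the function descends to the circle.\<close>

lemma circle_bump_function:
  assumes E: "E \<in> lmeasurable" "E \<subseteq> circle" "measure lebesgue E > 0" and \<tau>: "\<tau> > 0"
  obtains K U and f :: "complex \<Rightarrow> real" where "K \<subseteq> E" "K \<in> lmeasurable" "measure lebesgue K > 0"
    "U \<in> lmeasurable" "K \<subseteq> U" "measure lebesgue (U - K) < \<tau> * measure lebesgue K"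
    "continuous_on UNIV f" "\<And>z. 0 \<le> f z \<and> f z \<le> 1"
    "\<And>s. s \<in> K \<Longrightarrow> f (cis s) = 1" "\<And>s. s \<in> circle - U \<Longrightarrow> f (cis s) = 0"
proof -
  \<comment> \<open>The point 0, where the fundamental domain wraps around, is removed so that
    \<open>K\<close> lies inside the open interval (0, 2 pi).\<close>
  have "E - {0} \<in> lmeasurable" using E(1) lmeasurable_compact[of "{0}"] by (intro fmeasurable.Diff) auto
  have E0: "measure lebesgue (E - {0}) = measure lebesgue E"
    using E by (intro measure_Diff_null_set) (auto simp: fmeasurableD)
  \<comment> \<open>A defect smaller than the measure of \<open>E\<close> already forces
    \<open>K\<close> to have positive measure.\<close>
  obtain K where K: "closed K" "K \<subseteq> E - {0}" "E - {0} - K \<in> lmeasurable"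
      "emeasure lebesgue (E - {0} - K) < ennreal (measure lebesgue E)"
    by (rule sets_lebesgue_inner_closed[OF fmeasurableD[OF \<open>E - {0} \<in> lmeasurable\<close>] E(3)])
  have "bounded K" by (rule bounded_subset[of "{0..2*pi}"]) (use K E in \<open>auto simp: circle_def\<close>)
  then have "compact K" using K by (simp add: compact_eq_bounded_closed)
  then have Km: "K \<in> lmeasurable" by (rule lmeasurable_compact)
  have "measure lebesgue (E - {0} - K) < measure lebesgue E"
    using K(3,4) by (simp add: emeasure_eq_measure2 ennreal_less_iff)
  moreover have "measure lebesgue (E - {0} - K) = measure lebesgue (E - {0}) - measure lebesgue K"
    using K \<open>E - {0} \<in> lmeasurable\<close> Km by (intro measurable_measure_Diff) (auto simp: fmeasurableD)
  ultimately have Kpos: "measure lebesgue K > 0" using E0 by simp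
  then have \<tau>K: "\<tau> * measure lebesgue K > 0" using \<tau> by simp
  obtain T where T: "open T" "K \<subseteq> T" "T - K \<in> lmeasurable"
      "emeasure lebesgue (T - K) < ennreal (\<tau> * measure lebesgue K)"
    by (rule sets_lebesgue_outer_open[OF fmeasurableD[OF Km] \<tau>K])
  define U where "U = T \<inter> {0<..<2*pi}"
  have "open U" using T by (auto simp: U_def)
  have "U \<in> lmeasurable"
    by (rule lmeasurable_open[OF bounded_subset[of "{0..2*pi}"] \<open>open U\<close>]) (auto simp: U_def)
  have "K \<subseteq> U" using K T E by (fastforce simp: U_def circle_def)
  have "measure lebesgue (U - K) \<le> measure lebesgue (T - K)"
    using T Km \<open>U \<in> lmeasurable\<close> by (intro measure_mono_fmeasurable) (auto simp: U_def fmeasurableD)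
  also have "\<dots> < \<tau> * measure lebesgue K"
    using T(3,4) Kpos \<tau> by (simp add: emeasure_eq_measure2 ennreal_less_iff)
  finally have UK: "measure lebesgue (U - K) < \<tau> * measure lebesgue K" .
  define C where "C = {0..2*pi} - U"
  have "compact C" using \<open>open U\<close> by (simp add: C_def compact_diff)
  have cis_cont: "continuous_on X cis" for X :: "real set" by (intro continuous_intros)
  have disj: "cis ` K \<inter> cis ` C = {}"
  proof -
    have False if "s \<in> K" "t \<in> C" "cis s = cis t" for s t
    proof -
      have s: "0 < s" "s < 2 * pi" "s \<in> U" using \<open>s \<in> K\<close> \<open>K \<subseteq> U\<close> by (auto simp: U_def)
      have t: "0 \<le> t" "t \<le> 2 * pi" "t \<notin> U" using \<open>t \<in> C\<close> by (auto simp: C_def)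
      have two_pi: "0 < 2 * pi" by simp
      obtain n :: int where n: "s = t + 2 * pi * n"
        using \<open>cis s = cis t\<close> sin_cos_eq_iff[of s t] by (auto simp: complex_eq_iff)
      then have "2 * pi * real_of_int n < 2 * pi * 1" "2 * pi * (- 1) < 2 * pi * real_of_int n"
        using s t by linarith+
      then have "real_of_int n < 1" "- 1 < real_of_int n"
        unfolding mult_less_cancel_left_pos[OF two_pi] .
      then have "n = 0" by linarith
      then show False using n s t by simp
    qed
    then show ?thesis by blast
  qed
  have closed: "closed (cis ` K)" "closed (cis ` C)"
    by (rule compact_imp_closed[OF compact_continuous_image[OF cis_cont]], fact)+
  obtain f :: "complex \<Rightarrow> real" where f: "continuous_on UNIV f" "\<And>z. f z \<in> closed_segment 1 0"
      "\<And>z. z \<in> cis ` K \<Longrightarrow> f z = 1" "\<And>z. z \<in> cis ` C \<Longrightarrow> f z = 0"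
    by (rule Urysohn[OF closed disj, of "1::real" "0::real"]; rule that)
  show thesis
  proof (rule that[OF _ Km Kpos \<open>U \<in> lmeasurable\<close> \<open>K \<subseteq> U\<close> UK f(1)])
    show "K \<subseteq> E" using K by blast
    show "0 \<le> f z \<and> f z \<le> 1" for z using f(2)[of z] by (simp add: closed_segment_eq_real_ivl)
    show "f (cis s) = 1" if "s \<in> K" for s using that by (intro f(3)) blast
    show "f (cis s) = 0" if "s \<in> circle - U" for s
      using that by (intro f(4) imageI) (auto simp: C_def circle_def)
  qed
qed

text \<open>If the set \<open>E\<close> had positive measure, a real polynomial close to a bump on
  \<open>E\<close> would violate the weighted inequality: there the multiplicity is below \<delta>
  l, while the inequality compares it with a constant of at least 2 \<delta> l.\<close>

lemma low_multiplicity_set_null: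
  assumes S: "S \<subseteq> circle" "S \<in> sets lebesgue" and l: "l \<ge> 1"
    and \<Lambda>: "riesz_lower_bound S \<Lambda> A"
    and prog: "\<And>N. \<exists>M. (\<lambda>k. M + int k * int l) ` {1..N} \<subseteq> \<Lambda>"
    and \<delta>: "0 < \<delta>" "\<delta> \<le> 1 / 2" "2 * \<delta> \<le> A / (2 * pi)"
  shows "measure lebesgue (low_multiplicity_set \<delta> l S) = 0"
proof (rule ccontr)
  define E where "E = low_multiplicity_set \<delta> l S"
  assume "measure lebesgue (low_multiplicity_set \<delta> l S) \<noteq> 0"
  then have "measure lebesgue E > 0" by (simp add: E_def zero_less_measure_iff)
  then obtain K U and f :: "complex \<Rightarrow> real" where K: "K \<subseteq> E" "K \<in> lmeasurable" "measure lebesgue K > 0"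
    and U: "U \<in> lmeasurable" "K \<subseteq> U" "measure lebesgue (U - K) < \<delta> / 36 * measure lebesgue K"
    and f: "continuous_on UNIV f" "\<And>z. 0 \<le> f z \<and> f z \<le> 1"
      "\<And>s. s \<in> K \<Longrightarrow> f (cis s) = 1" "\<And>s. s \<in> circle - U \<Longrightarrow> f (cis s) = 0"
    using circle_bump_function[of E "\<delta> / 36"] low_multiplicity_set_measurable[OF S(2) l] \<delta>(1)
    by (auto simp: E_def low_multiplicity_set_def)
  \<comment> \<open>The errors are balanced against the gain \<delta>/4 times |K|: the ring
    \<open>U - K\<close> costs at most 9/4 * \<delta>/36 = \<delta>/16 times |K|, and the uniform
    error 2 pi \<epsilon>^2 costs at most the same. The cap 1/2 gives |h| between 1/2 and 3/2 on
    \<open>K\<close>.\<close>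
  define \<epsilon> where "\<epsilon> = min (1 / 2) (sqrt (\<delta> * measure lebesgue K / (32 * pi)))"
  have \<epsilon>: "\<epsilon> > 0" "\<epsilon> \<le> 1 / 2" using \<delta> K by (simp_all add: \<epsilon>_def)
  have "\<epsilon>\<^sup>2 \<le> (sqrt (\<delta> * measure lebesgue K / (32 * pi)))\<^sup>2"
    using \<epsilon>(1) by (intro power_mono) (auto simp: \<epsilon>_def)
  then have \<epsilon>2: "2 * pi * \<epsilon>\<^sup>2 \<le> \<delta> * measure lebesgue K / 16"
    using \<delta> K by (simp add: field_simps)
  obtain g where g: "real_polynomial_function g" "\<And>z. z \<in> sphere 0 1 \<Longrightarrow> \<bar>f z - g z\<bar> < \<epsilon>"
    using Stone_Weierstrass_real_polynomial_function[OF compact_sphere continuous_on_subset[OF f(1) subset_UNIV] \<epsilon>(1)]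
    by metis
  define h where "h = (\<lambda>s. g (cis s))"
  have fh: "\<bar>f (cis s) - h s\<bar> < \<epsilon>" for s using g(2) by (simp add: h_def)
  have h_le: "\<bar>h s\<bar> \<le> 3 / 2" for s using fh[of s] f(2)[of "cis s"] \<epsilon>(2) by linarith
  have h2_le: "(h s)\<^sup>2 \<le> 9 / 4" for s
    using power_mono[OF h_le[of s], of 2] by (simp add: power2_eq_square)
  have "continuous_on UNIV h"
    unfolding h_def by (intro continuous_on_compose2[OF continuous_on_polymonial_function[of g UNIV]] continuous_intros)
       (use g(1) in \<open>auto simp: real_polynomial_function_eq\<close>)
  then have hm: "h \<in> borel_measurable lebesgue" by (rule borel_measurable_lebesgue_continuous)
  define \<nu> where "\<nu> = (\<lambda>s. real (multiplicity_fun l S (s / real l)))"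
  have \<nu>m: "\<nu> \<in> borel_measurable lebesgue" unfolding \<nu>_def using multiplicity_fun_measurable[OF S(2) l] .
  have \<nu>_le: "0 \<le> \<nu> s" "\<nu> s \<le> real l" for s by (simp_all add: \<nu>_def multiplicity_fun_le)
  have int1: "set_integrable lebesgue circle (\<lambda>s. (h s)\<^sup>2)"
    using h2_le hm by (intro set_integrable_bounded[OF circle_lmeasurable, where B = "9 / 4"]) auto
  have int2: "set_integrable lebesgue circle (\<lambda>s. (h s)\<^sup>2 * \<nu> s)"
  proof (rule set_integrable_bounded[OF circle_lmeasurable, where B = "9 / 4 * real l"])
    show "norm ((h s)\<^sup>2 * \<nu> s) \<le> 9 / 4 * real l" for s
      using mult_mono[OF h2_le[of s] \<nu>_le(2)[of s]] \<nu>_le(1)[of s] by (simp add: abs_mult)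
  qed (use hm \<nu>m in measurable)
  have int3: "set_integrable lebesgue circle (indicat_real X)" if "X \<in> lmeasurable" for X
    by (rule set_integrable_bounded[OF circle_lmeasurable, where B = 1])
       (use that in \<open>auto simp: indicator_def fmeasurableD\<close>)
  have const_int: "set_integrable lebesgue circle (\<lambda>_. \<epsilon>\<^sup>2)"
    by (rule set_integrable_bounded[OF circle_lmeasurable, where B = "\<epsilon>\<^sup>2"]) auto
  have "K \<subseteq> circle" using K by (auto simp: E_def low_multiplicity_set_def)
  have UK: "U - K \<in> lmeasurable" using U K by (simp add: fmeasurable.Diff)
  have intK: "set_integrable lebesgue circle (\<lambda>s. \<delta> / 4 * indicat_real K s)"
    and intUK: "set_integrable lebesgue circle (\<lambda>s. 9 / 4 * indicat_real (U - K) s)"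
    using int3[OF K(2)] int3[OF UK] by simp_all
  note intD = set_integral_diff(1)[OF intK intUK]
  note int_left = set_integrable_mult_right[OF set_integral_diff(1)[OF intD const_int], of "real l"]
  have int_right: "set_integrable lebesgue circle (\<lambda>s. 2 * \<delta> * real l * (h s)\<^sup>2 - (h s)\<^sup>2 * \<nu> s)"
    using int1 int2 by (intro set_integral_diff(1)) simp_all
  \<comment> \<open>The left integrand is a pointwise minorant in three regions: on \<open>K\<close>
    the weight exceeds \<delta> l and h^2 is at least 1/4; on \<open>U - K\<close> the weight is at
    least -l and h^2 at most 9/4; outside \<open>U\<close>, h^2 is at most \<epsilon>^2.\<close>
  have "(LINT s:circle|lebesgue. real l * (\<delta> / 4 * indicat_real K s - 9 / 4 * indicat_real (U - K) s - \<epsilon>\<^sup>2))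
     \<le> (LINT s:circle|lebesgue. 2 * \<delta> * real l * (h s)\<^sup>2 - (h s)\<^sup>2 * \<nu> s)"
  proof (rule set_integral_mono)
    fix s assume s: "s \<in> circle"
    have low: "(h s)\<^sup>2 * (2 * \<delta> * real l - \<nu> s) \<ge> - (real l * (h s)\<^sup>2)"
    proof -
      have "0 \<le> (h s)\<^sup>2 * (2 * \<delta> * real l) + (h s)\<^sup>2 * (real l - \<nu> s)"
        using \<nu>_le[of s] \<delta> by simp
      then show ?thesis by (simp add: algebra_simps)
    qed
    have "real l * (\<delta> / 4 * indicat_real K s - 9 / 4 * indicat_real (U - K) s - \<epsilon>\<^sup>2) \<le>
       (h s)\<^sup>2 * (2 * \<delta> * real l - \<nu> s)"
    proof (cases "s \<in> K")
      case True
      have "h s \<ge> 1 / 2" using fh[of s] f(3)[OF True] \<epsilon>(2) by linarith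
      then have "(1 / 2)\<^sup>2 \<le> (h s)\<^sup>2" by (intro power_mono) auto
      moreover have "\<nu> s < \<delta> * real l" using True K by (auto simp: E_def low_multiplicity_set_def \<nu>_def)
      ultimately have "(1 / 2)\<^sup>2 * (\<delta> * real l) \<le> (h s)\<^sup>2 * (2 * \<delta> * real l - \<nu> s)"
        using \<delta> by (intro mult_mono) auto
      moreover have "real l * \<epsilon>\<^sup>2 \<ge> 0" by simp
      ultimately show ?thesis using True by (simp add: power2_eq_square algebra_simps)
    next
      case False
      show ?thesis
      proof (cases "s \<in> U")
        case True
        have "real l * (h s)\<^sup>2 \<le> real l * (9 / 4)" using h2_le by (intro mult_left_mono) auto
        moreover have "real l * \<epsilon>\<^sup>2 \<ge> 0" by simp
        moreover have "real l * (\<delta> / 4 * indicat_real K s - 9 / 4 * indicat_real (U - K) s - \<epsilon>\<^sup>2) =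
            - (real l * (9 / 4)) - real l * \<epsilon>\<^sup>2"
          using True False by (simp add: algebra_simps)
        ultimately show ?thesis using low by linarith
      next
        case nU: False
        have "\<bar>h s\<bar> \<le> \<epsilon>" using fh[of s] f(4)[of s] s nU by simp
        then have "(h s)\<^sup>2 \<le> \<epsilon>\<^sup>2" using power_mono[of "\<bar>h s\<bar>" \<epsilon> 2] by simp
        then have "real l * (h s)\<^sup>2 \<le> real l * \<epsilon>\<^sup>2" by (intro mult_left_mono) auto
        then show ?thesis using low nU False by (simp add: algebra_simps)
      qed
    qed
    then show "real l * (\<delta> / 4 * indicat_real K s - 9 / 4 * indicat_real (U - K) s - \<epsilon>\<^sup>2)
      \<le> 2 * \<delta> * real l * (h s)\<^sup>2 - (h s)\<^sup>2 * \<nu> s" by (simp add: algebra_simps)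
  qed (use int_left int_right in simp_all)
  also have "\<dots> = 2 * \<delta> * real l * (LINT s:circle|lebesgue. (h s)\<^sup>2) - (LINT s:circle|lebesgue. (h s)\<^sup>2 * \<nu> s)"
    using int1 int2 by (subst set_integral_diff(2)) auto
  \<comment> \<open>The Riesz lower bound enters here, through 2 \<delta> being at most A / (2
    pi).\<close>
  also have "\<dots> \<le> 0"
  proof -
    have "0 \<le> (LINT s:circle|lebesgue. (h s)\<^sup>2)"
      unfolding set_lebesgue_integral_def by (intro integral_nonneg_AE) auto
    then have "2 * \<delta> * (real l * (LINT s:circle|lebesgue. (h s)\<^sup>2)) \<le>
       A / (2 * pi) * (real l * (LINT s:circle|lebesgue. (h s)\<^sup>2))"
      using \<delta>(3) by (intro mult_right_mono) auto
    also have "\<dots> \<le> (LINT s:circle|lebesgue. (h s)\<^sup>2 * \<nu> s)"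
      using weighted_integral_real_polynomial[OF S l \<Lambda> prog g(1)] by (simp add: h_def \<nu>_def mult.assoc)
    finally show ?thesis by (simp add: mult.assoc)
  qed
  finally have "real l * (LINT s:circle|lebesgue. \<delta> / 4 * indicat_real K s - 9 / 4 * indicat_real (U - K) s - \<epsilon>\<^sup>2) \<le> 0"
    by simp
  moreover have "(LINT s:circle|lebesgue. \<delta> / 4 * indicat_real K s - 9 / 4 * indicat_real (U - K) s - \<epsilon>\<^sup>2) =
     \<delta> / 4 * measure lebesgue K - 9 / 4 * measure lebesgue (circle \<inter> (U - K)) - 2 * pi * \<epsilon>\<^sup>2"
  proof -
    have ind: "(LINT s:circle|lebesgue. indicat_real X s) = measure lebesgue (circle \<inter> X)" if "X \<in> lmeasurable" for X
      using that circle_lmeasurable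
      by (simp add: set_lebesgue_integral_def fmeasurableD flip: indicator_inter_arith)
    have "(LINT s:circle|lebesgue. \<epsilon>\<^sup>2) = 2 * pi * \<epsilon>\<^sup>2"
      by (subst set_integral_const[OF fmeasurableD[OF circle_lmeasurable]])
         (use fmeasurableD2[OF circle_lmeasurable] in \<open>simp_all add: measure_circle\<close>)
    then show ?thesis
      unfolding set_integral_diff(2)[OF intD const_int] set_integral_diff(2)[OF intK intUK]
      using \<open>K \<subseteq> circle\<close> by (simp add: ind[OF K(2)] ind[OF UK] inf_absorb2)
  qed
  ultimately have "\<delta> / 4 * measure lebesgue K - 9 / 4 * measure lebesgue (circle \<inter> (U - K)) - 2 * pi * \<epsilon>\<^sup>2 \<le> 0"
    using l by (simp add: mult_le_0_iff)
  moreover have "measure lebesgue (circle \<inter> (U - K)) \<le> measure lebesgue (U - K)"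
    using UK circle_lmeasurable by (intro measure_mono_fmeasurable) (auto simp: fmeasurableD)
  moreover have "\<delta> * measure lebesgue K > 0" using \<delta> K by simp
  ultimately show False using U(3) \<epsilon>2 by linarith
qed

lemma class_A_zero_imp_multiplicity_condition:
  assumes S: "S \<subseteq> circle" "S \<in> sets lebesgue" and "S \<in> class_A 0"
  shows "multiplicity_condition 0 S"
proof -
  define step where "step = (\<lambda>\<Lambda> N (l::nat). \<exists>M. (\<lambda>k. M + int k * int l) ` {1..N} \<subseteq> \<Lambda>)"
  obtain \<Lambda> C where riesz: "riesz_sequence \<Lambda> S" and
    W: "infinite {N :: nat. N \<ge> 1 \<and> (\<exists>M (l :: nat). l \<ge> 1 \<and> real l \<le> C * real N powr 0 \<and>
             (\<lambda>k. M + int k * int l) ` {1..N} \<subseteq> \<Lambda>)}" (is "infinite ?W")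
    using assms(3) unfolding class_A_def by blast
  \<comment> \<open>For exponent 0 the steps are bounded by \<open>C\<close>, so by pigeonhole one
    step \<open>l\<close> occurs for infinitely many lengths; truncation then gives every
    length.\<close>
  have sub: "?W \<subseteq> {N. \<exists>l\<in>{1..nat \<lfloor>C\<rfloor>}. step \<Lambda> N l}"
  proof
    fix N assume "N \<in> ?W"
    then obtain M and l :: nat where "N \<ge> 1" "l \<ge> 1" "real l \<le> C * real N powr 0"
      "(\<lambda>k. M + int k * int l) ` {1..N} \<subseteq> \<Lambda>" by blast
    then have l: "l \<ge> 1" "real l \<le> C" "step \<Lambda> N l" unfolding step_def by (simp, simp, blast)
    then have "l \<in> {1..nat \<lfloor>C\<rfloor>}" by (simp add: le_nat_floor)
    then show "N \<in> {N. \<exists>l\<in>{1..nat \<lfloor>C\<rfloor>}. step \<Lambda> N l}" using l by blast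
  qed
  have inf: "infinite {N. \<exists>l\<in>{1..nat \<lfloor>C\<rfloor>}. step \<Lambda> N l}"
    using W finite_subset[OF sub] by (rule contrapos_nn)
  obtain A where A: "A > 0" "riesz_lower_bound S \<Lambda> A"
    using riesz riesz_sequence_iff[OF S] by auto
  obtain l where l: "l \<ge> 1" "infinite {N. step \<Lambda> N l}"
  proof -
    have "{N. \<exists>l\<in>{1..nat \<lfloor>C\<rfloor>}. step \<Lambda> N l} = (\<Union>l\<in>{1..nat \<lfloor>C\<rfloor>}. {N. step \<Lambda> N l})" by auto
    then show ?thesis using inf that by auto
  qed
  have step: "step \<Lambda> N l" for N
  proof -
    obtain N' where "N \<le> N'" "step \<Lambda> N' l"
      using l(2) unfolding infinite_nat_iff_unbounded_le by blast
    then obtain M where "(\<lambda>k. M + int k * int l) ` {1..N'} \<subseteq> \<Lambda>" unfolding step_def by blast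
    moreover have "(\<lambda>k. M + int k * int l) ` {1..N} \<subseteq> (\<lambda>k. M + int k * int l) ` {1..N'}"
      using \<open>N \<le> N'\<close> by (intro image_mono) auto
    ultimately show ?thesis unfolding step_def by blast
  qed
  \<comment> \<open>The entry A / (4 pi) secures 2 \<delta> at most A / (2 pi); the entry 1/2 keeps
    \<delta> below 1.\<close>
  define \<delta> where "\<delta> = min (1 / 2) (A / (4 * pi))"
  have \<delta>: "0 < \<delta>" "\<delta> \<le> 1 / 2" "2 * \<delta> \<le> A / (2 * pi)"
    using \<open>A > 0\<close> by (auto simp: \<delta>_def min_def field_simps)
  \<comment> \<open>Every m-th term of a progression of step \<open>l\<close> and length N m forms
    one of step m l and length N. The multiples of \<open>l\<close> thus supply the infinitely many
    values required.\<close>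
  have null: "measure lebesgue (low_multiplicity_set \<delta> (m * l) S) = 0" if "m \<ge> 1" for m
  proof (rule low_multiplicity_set_null[OF S _ A(2) _ \<delta>])
    fix N
    obtain M where M: "(\<lambda>k. M + int k * int l) ` {1..N * m} \<subseteq> \<Lambda>" using step unfolding step_def by blast
    have "(\<lambda>k. M + int k * int (m * l)) ` {1..N} = (\<lambda>k. M + int k * int l) ` (\<lambda>k. k * m) ` {1..N}"
      by (simp add: image_image mult.assoc)
    also have "\<dots> \<subseteq> (\<lambda>k. M + int k * int l) ` {1..N * m}"
      using that by (intro image_mono) auto
    finally show "\<exists>M. (\<lambda>k. M + int k * int (m * l)) ` {1..N} \<subseteq> \<Lambda>" using M by blast
  qed (use that l in auto)
  have "infinite ((\<lambda>m. m * l) ` {1..})"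
    using l infinite_Ici by (subst finite_image_iff) (auto simp: inj_on_def)
  moreover have "(\<lambda>m. m * l) ` {1..} \<subseteq>
     {k. k \<ge> 1 \<and> measure lebesgue (low_multiplicity_set \<delta> k S) = 0}"
    using null l by auto
  ultimately have "infinite {k. k \<ge> 1 \<and> measure lebesgue (low_multiplicity_set \<delta> k S) = 0}"
    using finite_subset by blast
  then show ?thesis
    unfolding multiplicity_condition_def using \<delta> by (intro exI[of _ "1 / 2"] exI[of _ \<delta>]) auto
qed

theorem theorem4:
  fixes S :: "real set" and \<alpha> :: real
  assumes "S \<subseteq> circle" and "S \<in> sets lebesgue" and "measure lebesgue S > 0"
    and "0 \<le> \<alpha>" and "\<alpha> \<le> 1"
  shows "(multiplicity_condition \<alpha> S \<longrightarrow> S \<in> class_A \<alpha>) \<and>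
         (\<alpha> = 0 \<longrightarrow> S \<in> class_A \<alpha> \<longrightarrow> multiplicity_condition \<alpha> S)"
  using multiplicity_condition_imp_class_A class_A_zero_imp_multiplicity_condition assms by blast

end
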